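(* For all $n\geq 1$, the cohomology $\hat{h}^{\bullet}(\Pi^{\mathrm{Perm}}(n))$ is concentrated in degree $n-1$, and $$\dim\hat{h}^{n-1}(\Pi^{\mathrm{Perm}}(n)) = (n-1)^{n-1}.$$
   Context: Coefficients are in a commutative ring with unit $\mathbb{K}$, and $\dim$ denotes the rank as a $\mathbb{K}$-module; by convention $0^0=1$. $\Pi^{\mathrm{Perm}}(n)$ is the poset of pointed partitions of $\{1,\dots,n\}$: partitions in which each block has one distinguished (pointed) element, with $x\le y$ iff the partition of $x$ is obtained by merging blocks of $y$ and the pointed element of each block of $x$ is the pointed element of one of the blocks of $y$ that are merged into it. For a finite poset $P$, $\hat{c}^k(P)$ is the free $\mathbb{K}$-module on symbols $[x_0<\cdots<x_k]$ for chains in $P$ with $x_k$ a maximal element of $P$, with differential $d[x_0<\cdots<x_k]=\sum_{y<x_0}[y<x_0<\cdots<x_k]+\sum_{i=1}^k(-1)^i\sum_{x_{i-1}<y<x_i}[\cdots<x_{i-1}<y<x_i<\cdots]$, and $\hat{h}^\bullet(P)$ is its cohomology. (For $k\ge1$, $\hat{h}^k(P)\simeq\bigoplus_{y\in\max P}\widetilde{H}^{k-1}(P_{<y})$.) *)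

theory Defs
  imports
    "Jordan_Normal_Form.VS_Connect"
    "HOL-Algebra.AbelCoset"
    "HOL-Library.Disjoint_Sets"
    "HOL-Library.Poly_Mapping"
begin

section \<open>Modules\<close>

text \<open>The coefficient ring is a type of class \<open>comm_ring_1\<close>, which as a record is
  \<^term>\<open>class_ring\<close>. Modules are \<open>HOL-Algebra\<close> module records; their ring multiplication
  and unit fields carry no meaning and are left \<^term>\<open>undefined\<close>.\<close>

definition free_module :: "'s set \<Rightarrow> ('k::comm_ring_1, 's \<Rightarrow>\<^sub>0 'k) module" where
  "free_module S =
    \<lparr> carrier = {f. Poly_Mapping.keys f \<subseteq> S}, mult = undefined, one = undefined,
      zero = 0, add = (+), smult = (\<lambda>a f. Poly_Mapping.map ((*) a) f) \<rparr>"

text \<open>The union in the scalar multiplication equals the coset of \<open>a \<odot> x\<close> for any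
  representative \<open>x\<close> of \<open>X\<close>.\<close>

definition quotient_module :: "('k, 'm) module \<Rightarrow> 'm set \<Rightarrow> ('k, 'm set) module" where
  "quotient_module M N =
    \<lparr> carrier = a_rcosets\<^bsub>M\<^esub> N, mult = undefined, one = undefined,
      zero = N, add = (\<lambda>X Y. X <+>\<^bsub>M\<^esub> Y),
      smult = (\<lambda>a X. \<Union>x\<in>X. N +>\<^bsub>M\<^esub> (a \<odot>\<^bsub>M\<^esub> x)) \<rparr>"

definition free_of_rank :: "('k, 'a) ring_scheme \<Rightarrow> ('k, 'm, 'b) module_scheme \<Rightarrow> nat \<Rightarrow> bool" where
  "free_of_rank R M r \<longleftrightarrow> Module.module R M \<and>
    (\<exists>B \<subseteq> carrier M. finite B \<and> card B = r \<and>
       \<not> LinearCombinations.module.lin_dep R M B \<and>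
       LinearCombinations.module.span R M B = carrier M)"

section \<open>The cochain complex of a finite poset\<close>

text \<open>A poset is given by its carrier \<open>P\<close> and its order relation \<open>leq\<close> on \<open>P\<close>. A chain
  \<open>x\<^sub>0 < \<dots> < x\<^sub>k\<close> is the list of its elements in increasing order.\<close>

definition strictly :: "('a \<Rightarrow> 'a \<Rightarrow> bool) \<Rightarrow> 'a \<Rightarrow> 'a \<Rightarrow> bool" where
  "strictly leq x y \<longleftrightarrow> leq x y \<and> x \<noteq> y"

definition max_elements :: "'a set \<Rightarrow> ('a \<Rightarrow> 'a \<Rightarrow> bool) \<Rightarrow> 'a set" where
  "max_elements P leq = {x \<in> P. \<forall>y\<in>P. \<not> strictly leq x y}"

definition max_chains_of_length :: "'a set \<Rightarrow> ('a \<Rightarrow> 'a \<Rightarrow> bool) \<Rightarrow> nat \<Rightarrow> 'a list set" where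
  "max_chains_of_length P leq k =
    {xs. length xs = k + 1 \<and> set xs \<subseteq> P \<and> sorted_wrt (strictly leq) xs \<and>
         last xs \<in> max_elements P leq}"

definition cochains ::
    "'a set \<Rightarrow> ('a \<Rightarrow> 'a \<Rightarrow> bool) \<Rightarrow> nat \<Rightarrow> ('k::comm_ring_1, 'a list \<Rightarrow>\<^sub>0 'k) module" where
  "cochains P leq k = free_module (max_chains_of_length P leq k)"

definition chain_differential ::
    "'a set \<Rightarrow> ('a \<Rightarrow> 'a \<Rightarrow> bool) \<Rightarrow> 'a list \<Rightarrow> ('a list \<Rightarrow>\<^sub>0 'k::comm_ring_1)" where
  "chain_differential P leq xs =
    (\<Sum>y\<in>{y\<in>P. strictly leq y (hd xs)}. Poly_Mapping.single (y # xs) 1) +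
    (\<Sum>i=1..<length xs. \<Sum>y\<in>{y\<in>P. strictly leq (xs ! (i - 1)) y \<and> strictly leq y (xs ! i)}.
       Poly_Mapping.single (take i xs @ y # drop i xs) ((- 1) ^ i))"

definition differential ::
    "'a set \<Rightarrow> ('a \<Rightarrow> 'a \<Rightarrow> bool) \<Rightarrow> ('a list \<Rightarrow>\<^sub>0 'k::comm_ring_1) \<Rightarrow> ('a list \<Rightarrow>\<^sub>0 'k)" where
  "differential P leq f =
    (\<Sum>xs\<in>Poly_Mapping.keys f.
       Poly_Mapping.map ((*) (Poly_Mapping.lookup f xs)) (chain_differential P leq xs))"

definition cocycles ::
    "'a set \<Rightarrow> ('a \<Rightarrow> 'a \<Rightarrow> bool) \<Rightarrow> nat \<Rightarrow> ('a list \<Rightarrow>\<^sub>0 'k::comm_ring_1) set" where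
  "cocycles P leq k = {f \<in> carrier (cochains P leq k). differential P leq f = 0}"

definition coboundaries ::
    "'a set \<Rightarrow> ('a \<Rightarrow> 'a \<Rightarrow> bool) \<Rightarrow> nat \<Rightarrow> ('a list \<Rightarrow>\<^sub>0 'k::comm_ring_1) set" where
  "coboundaries P leq k =
    (if k = 0 then {0} else differential P leq ` carrier (cochains P leq (k - 1)))"

definition cohomology ::
    "'a set \<Rightarrow> ('a \<Rightarrow> 'a \<Rightarrow> bool) \<Rightarrow> nat \<Rightarrow> ('k::comm_ring_1, ('a list \<Rightarrow>\<^sub>0 'k) set) module" where
  "cohomology P leq k =
    quotient_module ((cochains P leq k) \<lparr> carrier := cocycles P leq k \<rparr>) (coboundaries P leq k)"

section \<open>Pointed partitions\<close>

text \<open>A pointed partition is the set of pairs (block, pointed element of that block);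
  injectivity of \<^term>\<open>fst\<close> says that each block has only one pointed element.\<close>

definition pointed_partitions :: "nat \<Rightarrow> (nat set \<times> nat) set set" where
  "pointed_partitions n =
    {x. partition_on {1..n} (fst ` x) \<and> inj_on fst x \<and> (\<forall>(B, p)\<in>x. p \<in> B)}"

text \<open>Coarser partitions are smaller: \<^term>\<open>refines A Q P\<close> says that \<open>Q\<close> is the finer one.\<close>

definition pointed_le :: "nat \<Rightarrow> (nat set \<times> nat) set \<Rightarrow> (nat set \<times> nat) set \<Rightarrow> bool" where
  "pointed_le n x y \<longleftrightarrow>
    refines {1..n} (fst ` y) (fst ` x) \<and> (\<forall>(B, p)\<in>x. \<exists>C. (C, p) \<in> y \<and> C \<subseteq> B)"

definition pointed_partition_cohomology ::
    "nat \<Rightarrow> nat \<Rightarrow> ('k::comm_ring_1, ((nat set \<times> nat) set list \<Rightarrow>\<^sub>0 'k) set) module" where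
  "pointed_partition_cohomology n k = cohomology (pointed_partitions n) (pointed_le n) k"

end

theory Submission
  imports Defs
begin

text \<open>Sending a number to the pointed element of its block identifies a pointed partition of
  \<open>{1..n}\<close> with an idempotent map \<open>h\<close>, and the order becomes the natural order of idempotents:
  \<open>g \<le> h\<close> iff \<open>g \<circ> h = g = h \<circ> g\<close>. In these terms it is easy to see that the poset, turned
  upside down, is totally semimodular (Chapoton and Vallette): two elements covered by \<open>x\<close> and
  lying above \<open>w\<close> cover a common element above \<open>w\<close>. Hence the part strictly below \<open>x\<close> is a union
  of cones that can be glued on one at a time, each along a union of cones of the same kind but of
  smaller rank. By the Mayer-Vietoris argument its reduced cohomology is free and concentrated in
  the top degree, over any coefficient ring, so its rank is the Euler characteristic up to sign. An
  element with \<open>m\<close> blocks has \<open>(m choose r) * r ^ (m - r)\<close> elements with \<open>r\<close> blocks below it, and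
  Abel's identity \<open>(\<Sum>r=1..m. (m choose r) * r ^ (m - r) * (1 - r) ^ (r - 1)) = 1\<close> turns the
  resulting recursion into the value \<open>(1 - n) ^ (n - 1)\<close>.\<close>

section \<open>Cochains on the chains of a poset\<close>

text \<open>Over an arbitrary coefficient ring freeness has to be carried through the gluing by
  hand: an explicit set of chains is kept whose indicator functions form a basis. Its size is not
  followed through the construction but read off at the end from the Euler characteristic, which
  obeys inclusion-exclusion. The pointed partition into singletons is the greatest element, so every
  chain of the complex ends in it. Removing it leaves the reduced complex of the rest of the poset,
  and a chain with \<open>k\<close> remaining elements has degree \<open>k\<close>. Cochains are
  total functions on lists. A primitive found on a subposet is thus already defined on the larger
  poset, and its values off the chains are harmless because faces of chains are chains. The apex of
  a cone is a greatest element and so comes last in a chain; adjoining it does not disturb the signs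
  of the other faces.\<close>

definition del :: "nat \<Rightarrow> 'a list \<Rightarrow> 'a list" where
  "del i c = take i c @ drop (Suc i) c"

text \<open>The dual form of the differential: instead of inserting elements into a chain, it
  collects the values of \<open>f\<close> at the faces of \<open>c\<close>. The empty list counts as
  a face, which makes the cohomology reduced.\<close>

definition coboundary :: "('a list \<Rightarrow> 'k::comm_ring_1) \<Rightarrow> 'a list \<Rightarrow> 'k" where
  "coboundary f c = (\<Sum>i<length c. (- 1) ^ i * f (del i c))"

definition strict_chains :: "('a \<Rightarrow> 'a \<Rightarrow> bool) \<Rightarrow> 'a set \<Rightarrow> 'a list set" where
  "strict_chains lt S = {c. set c \<subseteq> S \<and> sorted_wrt lt c}"

lemma length_del: "i < length c \<Longrightarrow> length (del i c) = length c - 1"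
  by (auto simp: del_def)

lemma set_del_subset: "set (del i c) \<subseteq> set c"
  by (auto simp: del_def dest: in_set_takeD in_set_dropD)

lemma del_append: "i < length c \<Longrightarrow> del i (c @ d) = del i c @ d"
  by (simp add: del_def)

lemma del_snoc_last: "del (length c) (c @ [z]) = c"
  by (simp add: del_def)

lemma sorted_wrt_del:
  assumes "sorted_wrt lt c" shows "sorted_wrt lt (del i c)"
proof -
  have "set (drop (Suc i) c) \<subseteq> set (drop i c)"
    by (metis drop_Suc in_set_dropD subsetI tl_drop drop_drop plus_1_eq_Suc)
  moreover from assms have "sorted_wrt lt (take i c @ drop i c)" by simp
  ultimately show ?thesis
    unfolding del_def sorted_wrt_append
    using assms by (auto simp: sorted_wrt_drop)
qed

lemma del_in_chains: "c \<in> strict_chains lt S \<Longrightarrow> del i c \<in> strict_chains lt S"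
  using set_del_subset[of i c] by (auto simp: strict_chains_def sorted_wrt_del)

lemma chains_mono: "S \<subseteq> T \<Longrightarrow> strict_chains lt S \<subseteq> strict_chains lt T"
  by (auto simp: strict_chains_def)

lemma chains_empty: "strict_chains lt {} = {[]}"
  by (auto simp: strict_chains_def)

lemma Nil_in_chains: "[] \<in> strict_chains lt S"
  by (simp add: strict_chains_def)

lemma chains_Int: "strict_chains lt (S \<inter> T) = strict_chains lt S \<inter> strict_chains lt T"
  by (auto simp: strict_chains_def)

lemma distinct_chain:
  assumes "c \<in> strict_chains lt S" and "\<And>x. x \<in> S \<Longrightarrow> \<not> lt x x"
  shows "distinct c"
  using assms by (induction c) (auto simp: strict_chains_def)

lemma finite_chains:
  assumes "finite S" and "\<And>x. x \<in> S \<Longrightarrow> \<not> lt x x"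
  shows "finite (strict_chains lt S)"
proof (rule finite_subset)
  show "strict_chains lt S \<subseteq> {c. set c \<subseteq> S \<and> length c \<le> card S}"
    using assms distinct_chain[of _ lt S]
    by (auto simp: strict_chains_def) (metis (no_types, lifting) card_mono strict_chains_def distinct_card mem_Collect_eq)
  show "finite {c. set c \<subseteq> S \<and> length c \<le> card S}"
    by (rule finite_lists_length_le[OF assms(1)])
qed

lemma coboundary_Nil [simp]: "coboundary f [] = 0"
  by (simp add: coboundary_def)

lemma coboundary_snoc:
  "coboundary f (c @ [z]) = coboundary (\<lambda>c. f (c @ [z])) c + (- 1) ^ length c * f c"
  by (simp add: coboundary_def del_append del_snoc_last)

lemma coboundary_add: "coboundary (\<lambda>c. f c + g c) c = coboundary f c + coboundary g c"
  by (simp add: coboundary_def algebra_simps sum.distrib)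

lemma coboundary_diff: "coboundary (\<lambda>c. f c - g c) c = coboundary f c - coboundary g c"
  by (simp add: coboundary_def algebra_simps sum_subtractf)

lemma coboundary_cong:
  assumes "\<And>i. i < length c \<Longrightarrow> f (del i c) = g (del i c)"
  shows "coboundary f c = coboundary g c"
  unfolding coboundary_def using assms by (intro sum.cong) auto

lemma coboundary_zero:
  assumes "\<And>i. i < length c \<Longrightarrow> f (del i c) = 0"
  shows "coboundary f c = 0"
  unfolding coboundary_def using assms by (intro sum.neutral) auto

text \<open>All faces of \<open>c\<close> are shorter by one, which flips the sign.\<close>

lemma coboundary_sign:
  "coboundary (\<lambda>c. (- 1) ^ length c * f c) c = - ((- 1) ^ length c) * coboundary f c"
proof (cases c)
  case (Cons a d)
  show ?thesis
    unfolding coboundary_def sum_distrib_left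
    by (intro sum.cong) (auto simp: length_del Cons)
qed simp

text \<open>Induction from the end: deleting \<open>z\<close> before or after another element gives
  two terms that cancel by \<open>coboundary_sign\<close>.\<close>

lemma coboundary_coboundary: "coboundary (coboundary f) c = 0"
proof (induction c arbitrary: f rule: rev_induct)
  case (snoc z c)
  have "coboundary (coboundary f) (c @ [z]) =
      coboundary (\<lambda>c. coboundary (\<lambda>c. f (c @ [z])) c + (- 1) ^ length c * f c) c
      + (- 1) ^ length c * coboundary f c"
    by (simp add: coboundary_snoc)
  then show ?case
    by (simp only: coboundary_add coboundary_sign snoc.IH) simp
qed simp

text \<open>The contracting homotopy of a cone with apex \<open>z\<close>.\<close>

definition cone_primitive :: "'a set \<Rightarrow> 'a \<Rightarrow> ('a list \<Rightarrow> 'k::comm_ring_1) \<Rightarrow> 'a list \<Rightarrow> 'k" where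
  "cone_primitive T z f c =
    (if set c \<subseteq> T - {z} then (- 1) ^ length c * f (c @ [z]) else 0)"

text \<open>A chain of length \<open>l\<close> is a simplex of dimension \<open>l - 1\<close>, so
  this is minus the usual reduced Euler characteristic.\<close>

definition euler :: "('a \<Rightarrow> 'a \<Rightarrow> bool) \<Rightarrow> 'a set \<Rightarrow> int" where
  "euler lt S = (\<Sum>c\<in>strict_chains lt S. (- 1) ^ length c)"

text \<open>Cochains are functions on all chains at once, the empty chain included, and the degree of a
  chain is its number of elements. So this says that the reduced cohomology lives in degree \<open>d\<close> and
  is freely generated by the (indicator functions of the) chains in \<open>B\<close>.\<close>

definition spherical ::
    "'k::comm_ring_1 itself \<Rightarrow> ('a \<Rightarrow> 'a \<Rightarrow> bool) \<Rightarrow> 'a set \<Rightarrow> nat \<Rightarrow> 'a list set \<Rightarrow> bool" where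
  "spherical K lt S d B \<longleftrightarrow>
     (\<forall>c\<in>strict_chains lt S. length c \<le> d) \<and>
     finite B \<and> B \<subseteq> strict_chains lt S \<and> (\<forall>c\<in>B. length c = d) \<and>
     (- 1) ^ d * int (card B) = euler lt S \<and>
     (\<forall>f :: 'a list \<Rightarrow> 'k. (\<forall>c\<in>strict_chains lt S. coboundary f c = 0) \<longrightarrow>
        (\<exists>g h. (\<forall>c. c \<notin> B \<longrightarrow> h c = 0) \<and> (\<forall>c\<in>strict_chains lt S. f c = coboundary g c + h c))) \<and>
     (\<forall>g h :: 'a list \<Rightarrow> 'k. (\<forall>c. c \<notin> B \<longrightarrow> h c = 0) \<longrightarrow>
        (\<forall>c\<in>strict_chains lt S. coboundary g c = h c) \<longrightarrow> (\<forall>c. h c = 0))"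

lemma sphericalD:
  fixes K :: "'k::comm_ring_1 itself" and g h :: "'a list \<Rightarrow> 'k"
  assumes "spherical K lt S d B"
  shows "c \<in> strict_chains lt S \<Longrightarrow> length c \<le> d"
    and "finite B"
    and "c \<in> B \<Longrightarrow> c \<in> strict_chains lt S"
    and "c \<in> B \<Longrightarrow> length c = d"
    and "(- 1) ^ d * int (card B) = euler lt S"
    and "\<lbrakk>\<And>c. c \<notin> B \<Longrightarrow> h c = 0; \<And>c. c \<in> strict_chains lt S \<Longrightarrow> coboundary g c = h c\<rbrakk> \<Longrightarrow> h c = 0"
proof -
  note conjs = assms[unfolded spherical_def]
  have indep: "\<forall>g h :: 'a list \<Rightarrow> 'k. (\<forall>c. c \<notin> B \<longrightarrow> h c = 0) \<longrightarrow>
      (\<forall>c\<in>strict_chains lt S. coboundary g c = h c) \<longrightarrow> (\<forall>c. h c = 0)"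
    using conjs by (elim conjE) assumption
  show "c \<in> strict_chains lt S \<Longrightarrow> length c \<le> d" "finite B"
    "c \<in> B \<Longrightarrow> c \<in> strict_chains lt S" "c \<in> B \<Longrightarrow> length c = d"
    "(- 1) ^ d * int (card B) = euler lt S"
    using conjs by auto
  show "h c = 0"
    if "\<And>c. c \<notin> B \<Longrightarrow> h c = 0" "\<And>c. c \<in> strict_chains lt S \<Longrightarrow> coboundary g c = h c"
    using indep[rule_format, of h g] that by simp
qed

lemma spherical_split:
  fixes K :: "'k::comm_ring_1 itself" and f :: "'a list \<Rightarrow> 'k"
  assumes "spherical K lt S d B" and "\<And>c. c \<in> strict_chains lt S \<Longrightarrow> coboundary f c = 0"
  obtains h g where "\<And>c. c \<notin> B \<Longrightarrow> h c = 0"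
    and "\<And>c. c \<in> strict_chains lt S \<Longrightarrow> f c = coboundary g c + h c"
proof -
  have "\<forall>f :: 'a list \<Rightarrow> 'k. (\<forall>c\<in>strict_chains lt S. coboundary f c = 0) \<longrightarrow>
      (\<exists>g h. (\<forall>c. c \<notin> B \<longrightarrow> h c = 0) \<and> (\<forall>c\<in>strict_chains lt S. f c = coboundary g c + h c))"
    using assms(1)[unfolded spherical_def] by (elim conjE) assumption
  then have "\<exists>g h. (\<forall>c. c \<notin> B \<longrightarrow> h c = 0) \<and> (\<forall>c\<in>strict_chains lt S. f c = coboundary g c + h c)"
    using assms(2) by simp
  then obtain g h where "\<forall>c. c \<notin> B \<longrightarrow> h c = 0" "\<forall>c\<in>strict_chains lt S. f c = coboundary g c + h c"
    by (elim exE conjE)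
  then show thesis by (intro that[where g = g and h = h]) (rule mp, erule spec, assumption, rule bspec)
qed

text \<open>Faces of chains have fewer than \<open>d\<close> elements. Hence every combination of
  basis chains is a cocycle.\<close>

lemma coboundary_top_zero:
  assumes "\<And>c. c \<in> strict_chains lt S \<Longrightarrow> length c \<le> d" and "\<And>c. length c \<noteq> d \<Longrightarrow> h c = 0"
    and "c \<in> strict_chains lt S"
  shows "coboundary h c = 0"
proof (rule coboundary_zero)
  fix i assume "i < length c"
  with assms(1)[OF assms(3)] show "h (del i c) = 0"
    by (intro assms(2)) (auto simp: length_del)
qed

lemma euler_empty: "euler lt {} = 1"
  by (simp add: euler_def chains_empty)

text \<open>The empty chain generates the reduced cohomology of the empty poset; the recursion on
  ranks ends here.\<close>

lemma spherical_empty: "spherical (K :: 'k::comm_ring_1 itself) lt {} 0 {[]}"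
proof -
  have "\<exists>g h. (\<forall>c. c \<notin> {[]} \<longrightarrow> h c = 0) \<and> (\<forall>c\<in>{[]}. f c = coboundary g c + h c)"
    for f :: "'a list \<Rightarrow> 'k"
    by (rule exI[of _ f], rule exI[of _ "\<lambda>c. if c = [] then f [] else 0"]) simp
  moreover have "\<forall>c. h c = 0"
    if "\<forall>c. c \<notin> {[]} \<longrightarrow> h c = 0" "\<forall>c\<in>{[]}. coboundary g c = h c" for g h :: "'a list \<Rightarrow> 'k"
    using that by (metis coboundary_Nil insertI1 insertE empty_iff)
  ultimately show ?thesis
    unfolding spherical_def chains_empty euler_empty by simp
qed

section \<open>Acyclicity of cones, and gluing a cone along a spherical base\<close>

locale cone =
  fixes lt :: "'a \<Rightarrow> 'a \<Rightarrow> bool" and T :: "'a set" and z :: 'a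
  assumes irrefl: "x \<in> T \<Longrightarrow> \<not> lt x x"
    and trans: "\<lbrakk>x \<in> T; y \<in> T; w \<in> T; lt x y; lt y w\<rbrakk> \<Longrightarrow> lt x w"
    and apex: "z \<in> T"
    and below_apex: "\<lbrakk>y \<in> T; y \<noteq> z\<rbrakk> \<Longrightarrow> lt y z"
begin

lemma snoc_in_chains: "c \<in> strict_chains lt (T - {z}) \<Longrightarrow> c @ [z] \<in> strict_chains lt T"
  using apex below_apex by (auto simp: strict_chains_def sorted_wrt_append)

lemma chain_cases:
  assumes "c \<in> strict_chains lt T"
  obtains "c \<in> strict_chains lt (T - {z})" | d where "d \<in> strict_chains lt (T - {z})" "c = d @ [z]"
proof (cases "z \<in> set c")
  case False
  then show ?thesis using assms that(1) by (auto simp: strict_chains_def)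
next
  case True
  then obtain d e where c: "c = d @ z # e" by (meson split_list)
  \<comment> \<open>An element after \<open>z\<close> would lie both above and below
    \<open>z\<close>.\<close>
  have "e = []"
  proof (rule ccontr)
    assume "e \<noteq> []"
    then obtain y where y: "y \<in> set e" by (cases e) auto
    then have "lt z y" "y \<in> T" using assms c by (auto simp: strict_chains_def sorted_wrt_append)
    moreover from this have "y \<noteq> z" using irrefl by blast
    ultimately show False using below_apex[of y] trans[of z y z] irrefl[of z] apex by blast
  qed
  moreover have "d \<in> strict_chains lt (T - {z})"
    using assms c irrefl by (auto simp: strict_chains_def sorted_wrt_append)
  ultimately show ?thesis using that(2) c by simp
qed

lemma chains_eq: "strict_chains lt T = strict_chains lt (T - {z}) \<union> (\<lambda>c. c @ [z]) ` strict_chains lt (T - {z})"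
  using snoc_in_chains chains_mono[of "T - {z}" T lt] by (auto elim: chain_cases)

text \<open>The chains pair off as \<open>c\<close> and \<open>c @ [z]\<close>, with opposite
  signs.\<close>

lemma euler_zero:
  assumes "finite T" shows "euler lt T = 0"
proof -
  have fin: "finite (strict_chains lt (T - {z}))"
    using assms irrefl by (intro finite_chains) auto
  have "euler lt T = euler lt (T - {z}) + (\<Sum>c\<in>(\<lambda>c. c @ [z]) ` strict_chains lt (T - {z}). (- 1) ^ length c)"
    unfolding euler_def by (subst chains_eq, rule sum.union_disjoint) (use fin in \<open>auto simp: strict_chains_def\<close>)
  also have "(\<Sum>c\<in>(\<lambda>c. c @ [z]) ` strict_chains lt (T - {z}). (- 1) ^ length c) = - euler lt (T - {z})"
    unfolding euler_def by (subst sum.reindex) (auto simp: inj_on_def sum_negf)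
  finally show ?thesis by simp
qed

text \<open>For a chain avoiding \<open>z\<close> this is the cocycle condition at
  \<open>c @ [z]\<close>. For \<open>d @ [z]\<close> every face except \<open>d\<close> still
  contains \<open>z\<close>, and there the primitive vanishes.\<close>

lemma coboundary_cone_primitive:
  fixes f :: "'a list \<Rightarrow> 'k::comm_ring_1"
  assumes cocycle: "\<And>c. c \<in> strict_chains lt T \<Longrightarrow> coboundary f c = 0" and c: "c \<in> strict_chains lt T"
  shows "f c = coboundary (cone_primitive T z f) c"
proof (cases rule: chain_cases[OF c])
  case 1
  have "coboundary (cone_primitive T z f) c =
      coboundary (\<lambda>c. (- 1) ^ length c * f (c @ [z])) c"
    using 1 set_del_subset[of _ c]
    by (intro coboundary_cong) (auto simp: cone_primitive_def strict_chains_def)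
  also have "\<dots> = - ((- 1) ^ length c) * coboundary (\<lambda>c. f (c @ [z])) c"
    by (rule coboundary_sign)
  also have "coboundary (\<lambda>c. f (c @ [z])) c = - ((- 1) ^ length c * f c)"
    using cocycle[OF snoc_in_chains[OF 1]] by (simp add: coboundary_snoc eq_neg_iff_add_eq_0)
  finally show ?thesis by (simp add: mult.assoc[symmetric] flip: power_add)
next
  case (2 d)
  have "coboundary (\<lambda>c. cone_primitive T z f (c @ [z])) d = 0"
    by (rule coboundary_zero) (simp add: cone_primitive_def)
  then have "coboundary (cone_primitive T z f) c = (- 1) ^ length d * cone_primitive T z f d"
    by (simp add: 2 coboundary_snoc)
  also have "\<dots> = f c"
    using 2 by (auto simp: cone_primitive_def strict_chains_def mult.assoc[symmetric] simp flip: power_add)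
  finally show ?thesis by simp
qed

text \<open>Vanishing cohomology is compatible with every bound \<open>d\<close> on the chain
  length, so a cone can start the gluing in whichever degree is wanted, with no generators.\<close>

lemma spherical_cone:
  assumes "finite T" and "\<And>c. c \<in> strict_chains lt T \<Longrightarrow> length c \<le> d"
  shows "spherical (K :: 'k::comm_ring_1 itself) lt T d {}"
proof -
  have "\<exists>g h. (\<forall>c. c \<notin> {} \<longrightarrow> h c = 0) \<and> (\<forall>c\<in>strict_chains lt T. f c = coboundary g c + h c)"
    if "\<forall>c\<in>strict_chains lt T. coboundary f c = 0" for f :: "'a list \<Rightarrow> 'k"
    using that coboundary_cone_primitive[of f]
    by (intro exI[of _ "cone_primitive T z f"] exI[of _ "\<lambda>_. 0"]) simp
  then show ?thesis
    using assms euler_zero unfolding spherical_def by simp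
qed

text \<open>Long exact sequence of the pair: relative to \<open>S'\<close>, the new chains are those of the cone \<open>T\<close>
  that do not lie in the base \<open>S' \<inter> T\<close>, and deleting the apex \<open>z\<close> cancels all of them except
  the chains \<open>c @ [z]\<close> with \<open>c\<close> in the base.\<close>

lemma spherical_glue:
  fixes K :: "'k::comm_ring_1 itself"
  assumes S': "spherical K lt S' (Suc d) B'" and R: "spherical K lt (S' \<inter> T) d BR"
    and z: "z \<notin> S'" and fin: "finite S'" "finite T"
    and irrefl': "\<And>x. x \<in> S' \<Longrightarrow> \<not> lt x x"
    and len_T: "\<And>c. c \<in> strict_chains lt T \<Longrightarrow> length c \<le> Suc d"
    and S: "strict_chains lt S = strict_chains lt S' \<union> strict_chains lt T"
  shows "spherical K lt S (Suc d) (B' \<union> (\<lambda>c. c @ [z]) ` BR)"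
proof -
  note S'D = sphericalD[OF S'] and RD = sphericalD[OF R]
  let ?B = "B' \<union> (\<lambda>c. c @ [z]) ` BR"
  have chains_R: "strict_chains lt (S' \<inter> T) \<subseteq> strict_chains lt (T - {z})"
    using z by (intro chains_mono) auto
  have R_snoc: "c @ [z] \<in> strict_chains lt T" if "c \<in> strict_chains lt (S' \<inter> T)" for c
    using that chains_R snoc_in_chains by blast
  have len: "length c \<le> Suc d" if "c \<in> strict_chains lt S" for c
    using that S S'D(1) len_T by blast
  have BR_z: "c \<in> strict_chains lt (S' \<inter> T)" if "c \<in> BR" for c using that by (rule RD(3))
  have z_notin: "z \<notin> set c" if "c \<in> strict_chains lt S'" for c
    using that z by (auto simp: strict_chains_def)
  have disj: "B' \<inter> (\<lambda>c. c @ [z]) ` BR = {}"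
    using S'D(3) z_notin by fastforce
  have top: "coboundary h c = 0"
    if "\<And>c. c \<notin> ?B \<Longrightarrow> h c = 0" "c \<in> strict_chains lt S" for h :: "'a list \<Rightarrow> 'k" and c
  proof (rule coboundary_top_zero[OF len _ that(2)])
    show "h c = 0" if "length c \<noteq> Suc d" for c
      using S'D(4) RD(4) that by (intro \<open>\<And>c. c \<notin> ?B \<Longrightarrow> h c = 0\<close>) auto
  qed
  have euler: "(- 1) ^ Suc d * int (card ?B) = euler lt S"
  proof -
    \<comment> \<open>Inclusion-exclusion on chains. The cone contributes 0, so the generators of
      the base enter with their degree raised by one.\<close>
    have "euler lt S + euler lt (S' \<inter> T) = euler lt S' + euler lt T"
      unfolding euler_def S chains_Int using fin irrefl irrefl'
      by (intro sum.union_inter finite_chains) auto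
    moreover have "card ?B = card B' + card BR"
      using disj S'D(2) RD(2) by (subst card_Un_disjoint) (auto simp: card_image inj_on_def)
    ultimately show ?thesis
      using S'D(5) RD(5) euler_zero fin by (simp add: algebra_simps)
  qed
  have split: "\<exists>g h. (\<forall>c. c \<notin> ?B \<longrightarrow> h c = 0) \<and> (\<forall>c\<in>strict_chains lt S. f c = coboundary g c + h c)"
    if cocycle: "\<forall>c\<in>strict_chains lt S. coboundary f c = 0" for f :: "'a list \<Rightarrow> 'k"
  proof -
    have cocycle_S': "coboundary f c = 0" if "c \<in> strict_chains lt S'" for c
      using cocycle S that by simp
    obtain g h where h: "\<And>c. c \<notin> B' \<Longrightarrow> h c = 0"
      and gh: "\<And>c. c \<in> strict_chains lt S' \<Longrightarrow> f c = coboundary g c + h c"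
      by (rule spherical_split[OF S' cocycle_S'], assumption, rule that)
    \<comment> \<open>Sphericity of \<open>S'\<close> removes everything that \<open>f\<close> does
      on \<open>S'\<close>.\<close>
    define f1 where "f1 c = f c - (coboundary g c + h c)" for c
    have f1_S': "f1 c = 0" if "c \<in> strict_chains lt S'" for c
      using gh[OF that] by (simp add: f1_def)
    have f1_cocycle: "coboundary f1 c = 0" if "c \<in> strict_chains lt S" for c
      unfolding f1_def coboundary_diff coboundary_add coboundary_coboundary
      using cocycle that top[of h c] h by simp
    \<comment> \<open>As \<open>f1\<close> vanishes at \<open>c\<close>, the cocycle condition at
      \<open>c @ [z]\<close> becomes one for the values at chains ending in \<open>z\<close>. This
      inverts the connecting map from the base to the pair.\<close>
    have f1_R: "coboundary (\<lambda>c. f1 (c @ [z])) c = 0" if "c \<in> strict_chains lt (S' \<inter> T)" for c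
      using f1_cocycle[of "c @ [z]"] f1_S'[of c] R_snoc[OF that] that
      by (simp add: coboundary_snoc S chains_Int)
    obtain \<psi> \<eta> where \<eta>: "\<And>c. c \<notin> BR \<Longrightarrow> \<eta> c = 0"
      and \<psi>: "\<And>c. c \<in> strict_chains lt (S' \<inter> T) \<Longrightarrow> f1 (c @ [z]) = coboundary \<psi> c + \<eta> c"
      by (rule spherical_split[OF R f1_R], assumption, rule that)
    \<comment> \<open>The connecting map on cochains: a function on the base is moved to lists
      ending in \<open>z\<close>, and vanishes on \<open>S'\<close>.\<close>
    define extend :: "('a list \<Rightarrow> 'k) \<Rightarrow> 'a list \<Rightarrow> 'k" where
      "extend u c = (if c \<noteq> [] \<and> last c = z then u (butlast c) else 0)" for u c
    have extend_S': "extend u c = 0" if "z \<notin> set c" for u c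
      using that by (auto simp: extend_def)
    have extend_supp: "extend \<eta> c = 0" if "c \<notin> (\<lambda>c. c @ [z]) ` BR" for c
      using that \<eta>[of "butlast c"] by (auto simp: extend_def) (metis append_butlast_last_id rev_image_eqI)
    \<comment> \<open>This cocycle vanishes on \<open>S'\<close> and, by the choice of
      \<open>\<psi>\<close> and \<open>\<eta>\<close>, also at \<open>c @ [z]\<close> for
      \<open>c\<close> in the base. Its cone primitive is therefore 0 on the base.\<close>
    define f2 where "f2 c = f1 c - (coboundary (extend \<psi>) c + extend \<eta> c)" for c
    have f2_cocycle: "coboundary f2 c = 0" if "c \<in> strict_chains lt S" for c
      unfolding f2_def coboundary_diff coboundary_add coboundary_coboundary
      using f1_cocycle that top[of "extend \<eta>" c] extend_supp by simp
    have coboundary_extend: "coboundary (extend u) c = 0" if "z \<notin> set c" for u c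
      using that set_del_subset[of _ c] by (intro coboundary_zero extend_S') blast
    have f2_S': "f2 c = 0" if "c \<in> strict_chains lt S'" for c
      unfolding f2_def using f1_S'[OF that] z_notin[OF that] by (simp add: coboundary_extend extend_S')
    have f2_R: "f2 (c @ [z]) = 0" if "c \<in> strict_chains lt (S' \<inter> T)" for c
    proof -
      have "z \<notin> set c" using that z_notin[of c] by (auto simp: chains_Int)
      then have "extend \<psi> c = 0" by (rule extend_S')
      moreover have "(\<lambda>c. extend u (c @ [z])) = u" for u by (simp add: extend_def)
      ultimately show ?thesis
        using \<psi>[OF that] by (simp add: f2_def coboundary_snoc) (simp add: extend_def)
    qed
    have "f2 c = coboundary (cone_primitive T z f2) c" if c: "c \<in> strict_chains lt S" for c
    proof (cases "c \<in> strict_chains lt T")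
      case True
      then show ?thesis using f2_cocycle S by (intro coboundary_cone_primitive) auto
    next
      case False
      with c S have c': "c \<in> strict_chains lt S'" by blast
      \<comment> \<open>A face of \<open>c\<close> either leaves \<open>T\<close>, where the
        primitive is 0 by definition, or lies in the base, where it is 0 by \<open>f2_R\<close>. So
        the primitive on the cone works on all of \<open>S\<close>.\<close>
      have "coboundary (cone_primitive T z f2) c = 0"
      proof (rule coboundary_zero)
        fix i
        have "del i c \<in> strict_chains lt S'" using c' by (rule del_in_chains)
        then show "cone_primitive T z f2 (del i c) = 0"
          using f2_R[of "del i c"]
          by (auto simp: cone_primitive_def strict_chains_def subset_Diff_insert)
      qed
      then show ?thesis using f2_S'[OF c'] by simp
    qed
    then have "f c = coboundary (\<lambda>c. g c + extend \<psi> c + cone_primitive T z f2 c) c + (h c + extend \<eta> c)"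
      if "c \<in> strict_chains lt S" for c
      using that unfolding coboundary_add by (simp add: f1_def f2_def algebra_simps)
    moreover have "h c + extend \<eta> c = 0" if "c \<notin> ?B" for c
      using that h extend_supp by simp
    ultimately show ?thesis
      by (intro exI[of _ "\<lambda>c. g c + extend \<psi> c + cone_primitive T z f2 c"]
          exI[of _ "\<lambda>c. h c + extend \<eta> c"] conjI allI impI ballI)
  qed
  have indep: "h c = 0"
    if h: "\<forall>c. c \<notin> ?B \<longrightarrow> h c = 0" and gh: "\<forall>c\<in>strict_chains lt S. coboundary g c = h c"
    for g h :: "'a list \<Rightarrow> 'k" and c
  proof -
    \<comment> \<open>The generators coming from \<open>BR\<close> contain \<open>z\<close>, so
      chains of \<open>S'\<close> see only the part of \<open>h\<close> on
      \<open>B'\<close>.\<close>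
    define h' where "h' c = (if c \<in> B' then h c else 0)" for c
    have h'_S': "coboundary g c = h' c" if "c \<in> strict_chains lt S'" for c
      using gh h S that z_notin[OF that] by (auto simp: h'_def)
    have "h' c = 0" for c
      by (rule S'D(6)[OF _ h'_S']) (simp add: h'_def)
    then have h_B': "h c = 0" if "c \<in> B'" for c using that by (simp add: h'_def) metis
    have g_S': "coboundary g c = 0" if "c \<in> strict_chains lt S'" for c
      using h'_S'[OF that] \<open>\<And>c. h' c = 0\<close> by simp
    obtain g1 h1 where h1: "\<And>c. c \<notin> B' \<Longrightarrow> h1 c = 0"
      and gh1: "\<And>c. c \<in> strict_chains lt S' \<Longrightarrow> g c = coboundary g1 c + h1 c"
      by (rule spherical_split[OF S' g_S'], assumption, rule that)
    \<comment> \<open>Subtracting a coboundary and a combination of top chains does not change the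
      coboundary of \<open>g\<close> on \<open>S\<close>. The result vanishes on \<open>S'\<close>,
      so its values at \<open>c @ [z]\<close> exhibit the rest of \<open>h\<close> as a coboundary
      on the base.\<close>
    define g2 where "g2 c = g c - (coboundary g1 c + h1 c)" for c
    have g2_R: "coboundary (\<lambda>c. g2 (c @ [z])) c = h (c @ [z])" if "c \<in> strict_chains lt (S' \<inter> T)" for c
    proof -
      have cz: "c @ [z] \<in> strict_chains lt S" using R_snoc[OF that] S by blast
      have "coboundary g2 (c @ [z]) = h (c @ [z])"
        unfolding g2_def coboundary_diff coboundary_add coboundary_coboundary
        using gh cz top[of h1 "c @ [z]"] h1 by simp
      moreover have "g2 c = 0" using gh1[of c] that by (simp add: g2_def chains_Int)
      ultimately show ?thesis by (simp add: coboundary_snoc)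
    qed
    have h_supp: "h (c @ [z]) = 0" if "c \<notin> BR" for c
    proof (cases "c @ [z] \<in> B'")
      case True
      then show ?thesis by (rule h_B')
    next
      case False
      then show ?thesis using h that by auto
    qed
    have "h (c @ [z]) = 0" for c
      by (rule RD(6)[where h = "\<lambda>c. h (c @ [z])", OF h_supp g2_R])
    then show ?thesis using h_B' h by blast
  qed
  have B: "?B \<subseteq> strict_chains lt S" "finite ?B" "\<forall>c\<in>?B. length c = Suc d"
    using S'D(2-4) RD(2,4) R_snoc[OF BR_z] unfolding S by auto
  show ?thesis
    unfolding spherical_def
    using len split indep by (intro conjI B euler) (blast, blast, blast)
qed

end

section \<open>Semimodular posets\<close>

text \<open>The lower bound \<open>w\<close> in \<open>diamond\<close> is what makes the
  semimodularity total. \<open>common_lower\<close> keeps the base of a gluing step nonempty. It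
  starts above rank 2 because the elements covered by one of rank 2 are minimal, and distinct
  minimal elements have no common lower bound.\<close>

locale semimodular =
  fixes P :: "'a set" and lt :: "'a \<Rightarrow> 'a \<Rightarrow> bool" and rk :: "'a \<Rightarrow> nat"
  assumes finite_P: "finite P"
    and lt_trans: "\<lbrakk>x \<in> P; y \<in> P; w \<in> P; lt x y; lt y w\<rbrakk> \<Longrightarrow> lt x w"
    and rk_pos: "x \<in> P \<Longrightarrow> 1 \<le> rk x"
    and rk_less: "\<lbrakk>x \<in> P; y \<in> P; lt x y\<rbrakk> \<Longrightarrow> rk x < rk y"
    and cover_between: "\<lbrakk>w \<in> P; x \<in> P; lt w x\<rbrakk> \<Longrightarrow>
      \<exists>u\<in>P. lt u x \<and> rk x = Suc (rk u) \<and> (w = u \<or> lt w u)"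
    and not_minimal: "\<lbrakk>x \<in> P; 1 < rk x\<rbrakk> \<Longrightarrow> \<exists>u\<in>P. lt u x"
    and diamond: "\<lbrakk>x \<in> P; u \<in> P; v \<in> P; w \<in> P; u \<noteq> v; lt u x; lt v x;
      rk x = Suc (rk u); rk x = Suc (rk v); w = u \<or> lt w u; w = v \<or> lt w v\<rbrakk> \<Longrightarrow>
      \<exists>z\<in>P. lt z u \<and> lt z v \<and> rk u = Suc (rk z) \<and> (w = z \<or> lt w z)"
    and common_lower: "\<lbrakk>x \<in> P; u \<in> P; v \<in> P; lt u x; lt v x;
      rk x = Suc (rk u); rk x = Suc (rk v); 2 < rk x\<rbrakk> \<Longrightarrow>
      \<exists>w\<in>P. (w = u \<or> lt w u) \<and> (w = v \<or> lt w v)"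
begin

lemma lt_irrefl: "x \<in> P \<Longrightarrow> \<not> lt x x"
  using rk_less by blast

definition covers :: "'a \<Rightarrow> 'a set" where
  "covers x = {u \<in> P. lt u x \<and> rk x = Suc (rk u)}"

definition down :: "'a set \<Rightarrow> 'a set" where
  "down F = {w \<in> P. \<exists>u\<in>F. w = u \<or> lt w u}"

definition below :: "'a \<Rightarrow> 'a set" where
  "below x = {w \<in> P. lt w x}"

text \<open>Ranks begin at 1 and increase strictly along a chain.\<close>

lemma length_chain:
  assumes "c \<in> strict_chains lt P" "\<And>x. x \<in> set c \<Longrightarrow> rk x \<le> m"
  shows "length c \<le> m"
  using assms
proof (induction c arbitrary: m rule: rev_induct)
  case (snoc z c)
  have z: "z \<in> P" "rk z \<le> m" using snoc.prems by (auto simp: strict_chains_def)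
  have "length c \<le> rk z - 1"
  proof (rule snoc.IH)
    show "c \<in> strict_chains lt P" using snoc.prems by (auto simp: strict_chains_def sorted_wrt_append)
    show "rk x \<le> rk z - 1" if "x \<in> set c" for x
      using rk_less[of x z] snoc.prems that by (fastforce simp: strict_chains_def sorted_wrt_append)
  qed
  then show ?case using z rk_pos[of z] by simp
qed simp

lemma cone_down: "u \<in> P \<Longrightarrow> cone lt (down {u}) u"
  unfolding cone_def down_def using lt_irrefl by (blast intro: lt_trans)

lemma length_chain_down:
  assumes "c \<in> strict_chains lt (down {u})" "u \<in> P"
  shows "length c \<le> rk u"
proof (rule length_chain)
  show "c \<in> strict_chains lt P"
    using assms(1) chains_mono[of "down {u}" P lt] by (auto simp: down_def)
  show "rk x \<le> rk u" if "x \<in> set c" for x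
    using assms that rk_less[of x u] by (force simp: strict_chains_def down_def)
qed

text \<open>A chain lies below its last element, hence in a single cone: no chain is spread over two
  of them.\<close>

lemma chains_down_insert:
  assumes "u \<in> P" "F \<subseteq> P"
  shows "strict_chains lt (down (insert u F)) = strict_chains lt (down F) \<union> strict_chains lt (down {u})"
proof
  show "strict_chains lt (down (insert u F)) \<subseteq> strict_chains lt (down F) \<union> strict_chains lt (down {u})"
  proof
    fix c assume c: "c \<in> strict_chains lt (down (insert u F))"
    have c_sub: "c \<in> strict_chains lt (down {v})"
      if d: "c = d @ [w]" and v: "v \<in> P" "w = v \<or> lt w v" for d w v
    proof -
      have "w \<in> P" using c d by (auto simp: strict_chains_def down_def)
      have "y \<in> down {v}" if "y \<in> set d" for y
      proof -
        have "y \<in> P" "lt y w" using c d that by (auto simp: strict_chains_def down_def sorted_wrt_append)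
        then show ?thesis using v lt_trans[of y w v] \<open>w \<in> P\<close> by (auto simp: down_def)
      qed
      then show ?thesis using c d v \<open>w \<in> P\<close> by (auto simp: strict_chains_def down_def)
    qed
    show "c \<in> strict_chains lt (down F) \<union> strict_chains lt (down {u})"
    proof (cases c rule: rev_cases)
      case Nil
      then show ?thesis by (simp add: Nil_in_chains)
    next
      case (snoc d w)
      then have "w \<in> down (insert u F)" using c by (simp add: strict_chains_def)
      then obtain v where v: "v \<in> insert u F" "w = v \<or> lt w v" by (auto simp: down_def)
      then have "c \<in> strict_chains lt (down {v})" using c_sub[OF snoc] assms by blast
      moreover have "v = u \<or> down {v} \<subseteq> down F" using v by (auto simp: down_def)
      ultimately show ?thesis using chains_mono by blast
    qed
  qed
  show "strict_chains lt (down F) \<union> strict_chains lt (down {u}) \<subseteq> strict_chains lt (down (insert u F))"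
    by (intro Un_least chains_mono) (auto simp: down_def)
qed

text \<open>Arbitrary nonempty sets of lower covers are allowed because the base of each gluing step
  is again of this form, with the new apex \<open>u\<close> in place of \<open>x\<close>. The outer
  induction is on the rank, the inner one on \<open>F\<close>.\<close>

lemma spherical_down:
  fixes K :: "'k::comm_ring_1 itself"
  assumes "x \<in> P" "F \<subseteq> covers x" "F \<noteq> {}"
  shows "\<exists>B. spherical K lt (down F) (rk x - 1) B"
  using assms
proof (induction "rk x" arbitrary: x F rule: less_induct)
  case less
  have "finite F" using less.prems finite_P by (auto simp: covers_def intro: finite_subset)
  from this \<open>F \<noteq> {}\<close> \<open>F \<subseteq> covers x\<close> show ?case
  proof (induction F rule: finite_ne_induct)
    case (singleton u)
    then have u: "u \<in> P" "rk x - 1 = rk u" by (auto simp: covers_def)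
    interpret cone lt "down {u}" u using u(1) by (rule cone_down)
    show ?case
      unfolding u(2) using finite_P length_chain_down[OF _ u(1)]
      by (intro exI[of _ "{}"] spherical_cone) (auto simp: down_def)
  next
    case (insert u F)
    then have u: "u \<in> P" "lt u x" "rk x = Suc (rk u)"
      and F: "\<And>v. v \<in> F \<Longrightarrow> v \<in> P \<and> lt v x \<and> rk x = Suc (rk v)"
      by (auto simp: covers_def)
    interpret cone lt "down {u}" u using u(1) by (rule cone_down)
    have "\<exists>B. spherical K lt (down F) (rk x - 1) B"
      using insert.prems by (intro insert.IH) simp
    then obtain B where B: "spherical K lt (down F) (rk u) B"
      unfolding u(3) diff_Suc_1 by blast
    \<comment> \<open>All lower covers of \<open>x\<close> have the same rank, so none lies below
      another.\<close>
    have u_notin: "u \<notin> down F"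
    proof
      assume "u \<in> down F"
      then obtain v where v: "v \<in> F" "u = v \<or> lt u v" by (auto simp: down_def)
      then have "lt u v" using insert.hyps by blast
      then show False using rk_less[of u v] u F[OF v(1)] by simp
    qed
    \<comment> \<open>By \<open>diamond\<close>, an element below both \<open>u\<close> and some
      \<open>v\<close> in \<open>F\<close> lies below a lower cover of \<open>u\<close> that is also
      below \<open>v\<close>. Hence these lower covers generate the base.\<close>
    let ?F = "covers u \<inter> down F"
    have R: "down F \<inter> down {u} = down ?F"
    proof (intro Set.set_eqI iffI)
      fix w assume w: "w \<in> down F \<inter> down {u}"
      then obtain v where v: "v \<in> F" "w = v \<or> lt w v" by (auto simp: down_def)
      have w': "w \<in> P" "w = u \<or> lt w u" using w by (auto simp: down_def)
      obtain z where z: "z \<in> P" "lt z u" "lt z v" "rk u = Suc (rk z)" "w = z \<or> lt w z"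
        using diamond[of x u v w] less.prems(1) u F[OF v(1)] w' v insert.hyps by metis
      then have "z \<in> ?F" using v by (auto simp: covers_def down_def)
      then show "w \<in> down ?F" using z(5) w'(1) by (auto simp: down_def)
    next
      fix w assume "w \<in> down ?F"
      then obtain z where z: "z \<in> P" "lt z u" "z \<in> down F" "w \<in> P" "w = z \<or> lt w z"
        by (auto simp: down_def covers_def)
      then obtain v where v: "v \<in> F" "z = v \<or> lt z v" by (auto simp: down_def)
      have "w = v \<or> lt w v" using z(1,4,5) v(2) F[OF v(1)] lt_trans[of w z v] by fast
      moreover have "lt w u" using z(1,2,4,5) u(1) lt_trans[of w z u] by fast
      ultimately show "w \<in> down F \<inter> down {u}" using z(4) v(1) by (auto simp: down_def)
    qed
    obtain B' where B': "spherical K lt (down F \<inter> down {u}) (rk u - 1) B'"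
    proof (cases "rk u = 1")
      case True
      \<comment> \<open>An element of rank 1 is minimal, so the cone is a point glued along the
        empty poset, of degree 0.\<close>
      have "down ?F = {}" using rk_pos True by (fastforce simp: down_def covers_def)
      then show ?thesis using that R True spherical_empty[of K lt] by simp
    next
      case False
      then have rk: "2 < rk x" using rk_pos[OF u(1)] u(3) by simp
      obtain v where v: "v \<in> F" using insert.hyps by blast
      \<comment> \<open>A common lower bound lies in the base, so \<open>?F\<close> is nonempty, as
        the outer induction hypothesis demands.\<close>
      obtain w where "w \<in> P" "w = u \<or> lt w u" "w = v \<or> lt w v"
        using common_lower[of x u v] less.prems(1) u F[OF v] rk by metis
      then have "w \<in> down ?F" using v unfolding R[symmetric] by (auto simp: down_def)
      then have "?F \<noteq> {}" by (auto simp: down_def)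
      then show ?thesis using less.hyps[of u ?F] u that R by auto
    qed
    have rk: "rk u = Suc (rk u - 1)" "rk x - 1 = Suc (rk u - 1)"
      using rk_pos[OF u(1)] u(3) by auto
    have "spherical K lt (down (insert u F)) (Suc (rk u - 1)) (B \<union> (\<lambda>c. c @ [u]) ` B')"
    proof (rule spherical_glue[OF _ B' u_notin])
      show "spherical K lt (down F) (Suc (rk u - 1)) B" using B by (subst rk(1)[symmetric])
      show "strict_chains lt (down (insert u F)) = strict_chains lt (down F) \<union> strict_chains lt (down {u})"
        using u(1) F by (intro chains_down_insert) blast+
      show "finite (down F)" "finite (down {u})" using finite_P by (simp_all add: down_def)
      show "\<not> lt y y" if "y \<in> down F" for y using that lt_irrefl by (simp add: down_def)
      show "length c \<le> Suc (rk u - 1)" if "c \<in> strict_chains lt (down {u})" for c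
        using length_chain_down[OF that u(1)] rk(1) by simp
    qed
    then show ?case unfolding rk(2) by blast
  qed
qed

lemma spherical_below:
  fixes K :: "'k::comm_ring_1 itself"
  assumes x: "x \<in> P"
  shows "\<exists>B. spherical K lt (below x) (rk x - 1) B"
proof (cases "rk x = 1")
  case True
  then have "below x = {}" using rk_less[OF _ x] rk_pos by (force simp: below_def)
  then show ?thesis using True spherical_empty[of K lt] by auto
next
  case False
  then have "1 < rk x" using rk_pos[OF x] by simp
  then have "covers x \<noteq> {}"
    using not_minimal[OF x] cover_between[OF _ x] unfolding covers_def by blast
  moreover have "below x = down (covers x)"
  proof (intro Set.set_eqI iffI)
    fix w assume "w \<in> below x"
    then show "w \<in> down (covers x)"
      using cover_between[of w x] x by (auto simp: below_def down_def covers_def)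
  next
    fix w assume "w \<in> down (covers x)"
    then show "w \<in> below x"
      using lt_trans[of w _ x] x by (auto simp: below_def down_def covers_def)
  qed
  ultimately show ?thesis using spherical_down[OF x subset_refl, of K] by simp
qed

text \<open>Sorting the nonempty chains by their last element gives the Moebius recursion.\<close>

lemma euler_below:
  assumes x: "x \<in> P"
  shows "euler lt (below x) = 1 - (\<Sum>w\<in>below x. euler lt (below w))"
proof -
  have fin: "finite (strict_chains lt (below w))" for w
    using finite_P lt_irrefl by (intro finite_chains) (auto simp: below_def)
  have "strict_chains lt (below x) = insert [] (\<Union>w\<in>below x. (\<lambda>c. c @ [w]) ` strict_chains lt (below w))"
    (is "_ = insert [] ?U")
  proof (intro Set.set_eqI iffI)
    fix c assume c: "c \<in> strict_chains lt (below x)"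
    show "c \<in> insert [] ?U"
    proof (cases c rule: rev_cases)
      case (snoc d w)
      then have "w \<in> below x" "d \<in> strict_chains lt (below w)"
        using c by (auto simp: strict_chains_def below_def sorted_wrt_append)
      then show ?thesis using snoc by blast
    qed simp
  next
    fix c assume "c \<in> insert [] ?U"
    then consider "c = []" | d w where "w \<in> below x" "d \<in> strict_chains lt (below w)" "c = d @ [w]"
      by blast
    then show "c \<in> strict_chains lt (below x)"
    proof cases
      case 2
      have "lt y x" if "y \<in> set d" for y
        using that 2 lt_trans[of y w x] x by (auto simp: strict_chains_def below_def)
      then show ?thesis using 2 by (auto simp: strict_chains_def below_def sorted_wrt_append)
    qed (simp add: Nil_in_chains)
  qed
  then have "euler lt (below x) = (\<Sum>c\<in>insert [] ?U. (- 1) ^ length c)"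
    by (simp add: euler_def)
  also have "\<dots> = 1 + (\<Sum>c\<in>?U. (- 1) ^ length c)"
    using fin finite_P by (subst sum.insert) (auto simp: below_def)
  also have "(\<Sum>c\<in>?U. (- 1) ^ length c :: int)
      = (\<Sum>w\<in>below x. \<Sum>c\<in>(\<lambda>c. c @ [w]) ` strict_chains lt (below w). (- 1) ^ length c)"
    using fin finite_P by (intro sum.UNION_disjoint) (auto simp: below_def)
  also have "\<dots> = (\<Sum>w\<in>below x. - euler lt (below w))"
    unfolding euler_def by (intro sum.cong) (auto simp: sum.reindex inj_on_def sum_negf)
  finally show ?thesis by (simp add: sum_negf)
qed

end

section \<open>Abel's identity\<close>

text \<open>Pascal's rule; it splits a single difference off an iterated one.\<close>

lemma sum_choose_Suc:
  fixes a :: "nat \<Rightarrow> int"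
  shows "(\<Sum>r\<le>Suc s. int (Suc s choose r) * a r) = (\<Sum>r\<le>s. int (s choose r) * (a r + a (Suc r)))"
proof -
  have "(\<Sum>r\<le>Suc s. int (Suc s choose r) * a r)
      = a 0 + (\<Sum>r\<le>s. int (s choose r) * a (Suc r)) + (\<Sum>r\<le>s. int (s choose Suc r) * a (Suc r))"
    by (subst sum.atMost_Suc_shift) (simp add: algebra_simps sum.distrib)
  also have "a 0 + (\<Sum>r\<le>s. int (s choose r) * a (Suc r)) + (\<Sum>r\<le>s. int (s choose Suc r) * a (Suc r))
      = (\<Sum>r\<le>Suc s. int (s choose r) * a r) + (\<Sum>r\<le>s. int (s choose r) * a (Suc r))"
    using sum.atMost_Suc_shift[of "\<lambda>r. int (s choose r) * a r" s] by simp
  finally show ?thesis by (simp add: algebra_simps sum.distrib)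
qed

text \<open>An \<open>s\<close>-fold finite difference annihilates polynomials of degree below
  \<open>s\<close>: a single difference of a \<open>k\<close>-th power is a combination of lower
  powers, to which the induction hypothesis applies.\<close>

lemma alternating_sum_power:
  fixes x :: int
  assumes "k < s"
  shows "(\<Sum>r\<le>s. int (s choose r) * ((- 1) ^ r * (x - int r) ^ k)) = 0"
  using assms
proof (induction s arbitrary: k)
  case (Suc s)
  have diff: "(x - int r) ^ k - (x - int (Suc r)) ^ k
      = (\<Sum>j<k. - (int (k choose j) * (- 1) ^ (k - j)) * (x - int r) ^ j)" for r
  proof -
    have "(x - int (Suc r)) ^ k = ((x - int r) + (- 1)) ^ k"
      by (rule arg_cong[where f = "\<lambda>y. y ^ k"]) simp
    also have "\<dots> = (\<Sum>j\<le>k. int (k choose j) * (x - int r) ^ j * (- 1) ^ (k - j))"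
      by (rule binomial_ring)
    also have "\<dots> = (x - int r) ^ k + (\<Sum>j<k. int (k choose j) * (x - int r) ^ j * (- 1) ^ (k - j))"
      by (simp add: lessThan_Suc_atMost[symmetric])
    finally show ?thesis by (simp add: sum_negf algebra_simps)
  qed
  have "(\<Sum>r\<le>Suc s. int (Suc s choose r) * ((- 1) ^ r * (x - int r) ^ k))
      = (\<Sum>r\<le>s. int (s choose r) * ((- 1) ^ r * ((x - int r) ^ k - (x - int (Suc r)) ^ k)))"
    by (subst sum_choose_Suc) (simp add: algebra_simps)
  also have "\<dots> = (\<Sum>r\<le>s. \<Sum>j<k. - (int (k choose j) * (- 1) ^ (k - j)) *
      (int (s choose r) * ((- 1) ^ r * (x - int r) ^ j)))"
    unfolding diff by (simp add: sum_distrib_left mult_ac)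
  also have "\<dots> = (\<Sum>j<k. - (int (k choose j) * (- 1) ^ (k - j)) *
      (\<Sum>r\<le>s. int (s choose r) * ((- 1) ^ r * (x - int r) ^ j)))"
    by (subst sum.swap) (simp add: sum_distrib_left)
  also have "\<dots> = 0"
    using Suc by (intro sum.neutral) simp
  finally show ?case .
qed simp

text \<open>Writing \<open>r\<close> as \<open>- (1 - r) + 1\<close> and expanding collects a power
  of \<open>1 - r\<close> with exponent \<open>s - 1\<close>, which no longer depends on
  \<open>r\<close>. For fixed \<open>s\<close> the sum over \<open>r\<close> is then an
  \<open>s\<close>-fold difference of a polynomial of degree \<open>s - 1\<close>, apart from the
  missing term at \<open>r = 0\<close>.\<close>

lemma abel_identity:
  assumes "1 \<le> m"
  shows "(\<Sum>r=1..m. int (m choose r) * int r ^ (m - r) * (1 - int r) ^ (r - 1)) = 1"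
proof -
  have term_eq: "int (m choose r) * int r ^ (m - r) * (1 - int r) ^ (r - 1) =
      (\<Sum>s=1..m. int (m choose s) * (int (s choose r) * ((- 1) ^ s * (- 1) ^ r) * (1 - int r) ^ (s - 1)))"
    if r: "r \<in> {1..m}" for r
  proof -
    have "int r ^ (m - r) = (- (1 - int r) + 1) ^ (m - r)" by simp
    also have "\<dots> = (\<Sum>j\<le>m - r. int (m - r choose j) * (- (1 - int r)) ^ j)"
      unfolding binomial_ring by simp
    also have "\<dots> = (\<Sum>s=r..m. int (m - r choose (s - r)) * (- (1 - int r)) ^ (s - r))"
      by (rule sum.reindex_bij_witness[where i = "\<lambda>s. s - r" and j = "\<lambda>j. j + r"]) (use r in auto)
    finally have "int (m choose r) * int r ^ (m - r) * (1 - int r) ^ (r - 1) =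
        (\<Sum>s=r..m. int (m choose r) * int (m - r choose (s - r)) *
          ((- (1 - int r)) ^ (s - r) * (1 - int r) ^ (r - 1)))"
      by (simp add: sum_distrib_left sum_distrib_right mult_ac)
    also have "\<dots> = (\<Sum>s=r..m. int (m choose s) * (int (s choose r) * ((- 1) ^ s * (- 1) ^ r) * (1 - int r) ^ (s - 1)))"
    proof (rule sum.cong)
      fix s assume s: "s \<in> {r..m}"
      \<comment> \<open>Choosing an \<open>r\<close>-set and enlarging it to an \<open>s\<close>-set
        is the same as choosing the \<open>s\<close>-set first.\<close>
      have "int (m choose r) * int (m - r choose (s - r)) = int (m choose s) * int (s choose r)"
        using choose_mult[of r s m] s by (simp flip: of_nat_mult)
      moreover have "(- (1 - int r)) ^ (s - r) = (- 1) ^ s * (- 1) ^ r * (1 - int r) ^ (s - r)"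
      proof -
        have "(- (1 - int r)) ^ (s - r) = (- 1) ^ (s - r) * (1 - int r) ^ (s - r)"
          by (rule power_minus)
        moreover have "(- 1 :: int) ^ (s - r) = (- 1) ^ s * (- 1) ^ r"
          using s by (metis (no_types, lifting) atLeastAtMost_iff le_add_diff_inverse2 minus_one_mult_self mult.assoc mult.right_neutral power_add)
        ultimately show ?thesis by simp
      qed
      moreover have "(1 - int r) ^ (s - r) * (1 - int r) ^ (r - 1) = (1 - int r) ^ (s - 1)"
        using s r by (simp flip: power_add)
      ultimately show "int (m choose r) * int (m - r choose (s - r)) *
          ((- (1 - int r)) ^ (s - r) * (1 - int r) ^ (r - 1)) =
          int (m choose s) * (int (s choose r) * ((- 1) ^ s * (- 1) ^ r) * (1 - int r) ^ (s - 1))"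
        by (simp add: mult.assoc)
    qed simp
    also have "\<dots> = (\<Sum>s=1..m. int (m choose s) * (int (s choose r) * ((- 1) ^ s * (- 1) ^ r) * (1 - int r) ^ (s - 1)))"
      using r by (intro sum.mono_neutral_left) (auto simp: binomial_eq_0)
    finally show ?thesis .
  qed
  have inner: "(\<Sum>r=1..m. int (s choose r) * ((- 1) ^ s * (- 1) ^ r) * (1 - int r) ^ (s - 1)) = - ((- 1) ^ s)"
    if s: "s \<in> {1..m}" for s
  proof -
    \<comment> \<open>The sum over all \<open>r\<close> from 0 vanishes, so only the removed term at
      \<open>r = 0\<close> survives, with its sign reversed.\<close>
    have "(\<Sum>r=1..m. int (s choose r) * ((- 1) ^ s * (- 1) ^ r) * (1 - int r) ^ (s - 1))
        = (\<Sum>r\<in>{..s} - {0}. int (s choose r) * ((- 1) ^ s * (- 1) ^ r) * (1 - int r) ^ (s - 1))"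
      using s by (intro sum.mono_neutral_right) (auto simp: binomial_eq_0)
    also have "\<dots> = (\<Sum>r\<le>s. int (s choose r) * ((- 1) ^ s * (- 1) ^ r) * (1 - int r) ^ (s - 1)) - (- 1) ^ s"
      by (subst sum_diff1) auto
    also have "(\<Sum>r\<le>s. int (s choose r) * ((- 1) ^ s * (- 1) ^ r) * (1 - int r) ^ (s - 1))
        = (- 1) ^ s * (\<Sum>r\<le>s. int (s choose r) * ((- 1) ^ r * (1 - int r) ^ (s - 1)))"
      by (simp add: sum_distrib_left mult_ac)
    also have "\<dots> = 0" using alternating_sum_power[of "s - 1" s 1] s by simp
    finally show ?thesis by simp
  qed
  have "(\<Sum>r=1..m. int (m choose r) * int r ^ (m - r) * (1 - int r) ^ (r - 1))
      = (\<Sum>r=1..m. \<Sum>s=1..m.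
          int (m choose s) * (int (s choose r) * ((- 1) ^ s * (- 1) ^ r) * (1 - int r) ^ (s - 1)))"
    by (intro sum.cong refl term_eq)
  also have "\<dots> = (\<Sum>s=1..m. int (m choose s) *
          (\<Sum>r=1..m. int (s choose r) * ((- 1) ^ s * (- 1) ^ r) * (1 - int r) ^ (s - 1)))"
    by (subst sum.swap) (simp add: sum_distrib_left)
  also have "\<dots> = (\<Sum>s=1..m. int (m choose s) * - ((- 1) ^ s))"
    using inner by (intro sum.cong) auto
  also have "\<dots> = - (\<Sum>s\<in>{..m} - {0}. (- 1) ^ s * int (m choose s))"
    by (subst sum_negf[symmetric], intro sum.cong) auto
  also have "\<dots> = 1"
    using choose_alternating_sum[of m, where ?'a = int] assms by (subst sum_diff1) auto
  finally show ?thesis .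
qed

section \<open>Euler characteristics and ranks from the number of elements of each rank\<close>

locale abel_poset = semimodular +
  assumes card_rank_below: "x \<in> P \<Longrightarrow>
    card {w \<in> P. (w = x \<or> lt w x) \<and> rk w = r} = (rk x choose r) * r ^ (rk x - r)"
begin

text \<open>By \<open>euler_below\<close> the values over \<open>x\<close> and everything below it
  add up to 1. Grouped by rank, the claimed values satisfy the same equation by Abel's identity. In
  rank 1 the value is \<open>0 ^ 0 = 1\<close>, that of the empty poset.\<close>

lemma euler_below_eq:
  assumes "x \<in> P"
  shows "euler lt (below x) = (1 - int (rk x)) ^ (rk x - 1)"
  using assms
proof (induction "rk x" arbitrary: x rule: less_induct)
  case less
  let ?f = "\<lambda>r. (1 - int r) ^ (r - 1)"
  let ?I = "insert x (below x)"
  have fin: "finite (below x)" using finite_P by (simp add: below_def)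
  have "x \<notin> below x" using lt_irrefl by (simp add: below_def)
  have rk_I: "rk ` ?I \<subseteq> {1..rk x}"
    using rk_pos rk_less[OF _ less.prems] less.prems by (force simp: below_def)
  have "(\<Sum>w\<in>?I. ?f (rk w)) = (\<Sum>r=1..rk x. \<Sum>w\<in>{w\<in>?I. rk w = r}. ?f (rk w))"
    using fin rk_I by (intro sum.group[symmetric]) auto
  also have "\<dots> = (\<Sum>r=1..rk x. int (rk x choose r) * int r ^ (rk x - r) * ?f r)"
  proof (rule sum.cong)
    fix r
    have "{w \<in> ?I. rk w = r} = {w \<in> P. (w = x \<or> lt w x) \<and> rk w = r}"
      using less.prems by (auto simp: below_def)
    then show "(\<Sum>w\<in>{w\<in>?I. rk w = r}. ?f (rk w)) = int (rk x choose r) * int r ^ (rk x - r) * ?f r"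
      using card_rank_below[OF less.prems, of r] by simp
  qed simp
  also have "\<dots> = 1" using rk_pos[OF less.prems] by (rule abel_identity)
  finally have "?f (rk x) + (\<Sum>w\<in>below x. ?f (rk w)) = 1"
    using fin \<open>x \<notin> below x\<close> by simp
  moreover have "(\<Sum>w\<in>below x. euler lt (below w)) = (\<Sum>w\<in>below x. ?f (rk w))"
    using less.hyps rk_less less.prems by (intro sum.cong) (auto simp: below_def)
  ultimately show ?case using euler_below[OF less.prems] by simp
qed

lemma spherical_below_card:
  fixes K :: "'k::comm_ring_1 itself"
  assumes "x \<in> P"
  obtains B where "spherical K lt (below x) (rk x - 1) B" "card B = (rk x - 1) ^ (rk x - 1)"
proof -
  obtain B where B: "spherical K lt (below x) (rk x - 1) B"
    using spherical_below[OF assms] by blast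
  \<comment> \<open>Both sides carry the same sign, which cancels and leaves a count of
    generators.\<close>
  have "1 - int (rk x) = - 1 * int (rk x - 1)" using rk_pos[OF assms] by (simp add: of_nat_diff)
  then have "(- 1) ^ (rk x - 1) * int (card B) = (- 1) ^ (rk x - 1) * int ((rk x - 1) ^ (rk x - 1))"
    using sphericalD(5)[OF B] euler_below_eq[OF assms] by (simp only: power_mult_distrib of_nat_power)
  then have "card B = (rk x - 1) ^ (rk x - 1)"
    by (simp only: mult_cancel_left) (simp only: of_nat_eq_iff, auto)
  with B that show thesis by blast
qed

end

section \<open>Idempotent maps\<close>

text \<open>Fixing everything outside \<open>{1..n}\<close> makes the maps equal as soon as they
  agree on \<open>{1..n}\<close>, and lets idempotency and the order be stated for all
  arguments.\<close>

definition idem_maps :: "nat \<Rightarrow> (nat \<Rightarrow> nat) set" where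
  "idem_maps n = {h. (\<forall>i. h (h i) = h i) \<and> (\<forall>i\<in>{1..n}. h i \<in> {1..n}) \<and> (\<forall>i. i \<notin> {1..n} \<longrightarrow> h i = i)}"

text \<open>The first clause says that fibres of \<open>h\<close> are merged, the second that the
  points of \<open>g\<close> are among the points of \<open>h\<close>.\<close>

definition idem_le :: "('a \<Rightarrow> 'a) \<Rightarrow> ('a \<Rightarrow> 'a) \<Rightarrow> bool" where
  "idem_le g h \<longleftrightarrow> (\<forall>i. g (h i) = g i) \<and> (\<forall>i. h (g i) = g i)"

definition idem_rank :: "nat \<Rightarrow> (nat \<Rightarrow> nat) \<Rightarrow> nat" where
  "idem_rank n h = card (h ` {1..n})"

text \<open>The fibre over \<open>a\<close> is merged into the one over \<open>b\<close>, which
  keeps its point. These are the elements covered by \<open>h\<close>.\<close>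

definition contract :: "('a \<Rightarrow> 'a) \<Rightarrow> 'a \<Rightarrow> 'a \<Rightarrow> 'a \<Rightarrow> 'a" where
  "contract h a b i = (if h i = a then b else h i)"

lemma idem_le_refl: "h \<in> idem_maps n \<Longrightarrow> idem_le h h"
  by (simp add: idem_le_def idem_maps_def)

lemma idem_le_trans: "idem_le f g \<Longrightarrow> idem_le g h \<Longrightarrow> idem_le f h"
  unfolding idem_le_def by metis

lemma idem_le_antisym: "idem_le g h \<Longrightarrow> idem_le h g \<Longrightarrow> g = h"
  unfolding idem_le_def by (metis ext)

lemma idem_fixed: "h \<in> idem_maps n \<Longrightarrow> a \<in> h ` {1..n} \<longleftrightarrow> a \<in> {1..n} \<and> h a = a"
  unfolding idem_maps_def image_iff by (metis (mono_tags, lifting) mem_Collect_eq)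

lemma image_mono_idem:
  assumes "idem_le g h" "h \<in> idem_maps n" "g \<in> idem_maps n"
  shows "g ` {1..n} \<subseteq> h ` {1..n}"
  using assms unfolding idem_le_def by (metis (no_types, lifting) idem_fixed subsetI)

text \<open>The smaller image is contained in the larger, so the images agree. Then \<open>g\<close>
  fixes \<open>h i\<close>, and \<open>g i = g (h i) = h i\<close>.\<close>

lemma idem_le_rank_eq:
  assumes "idem_le g h" "h \<in> idem_maps n" "g \<in> idem_maps n" "idem_rank n h \<le> idem_rank n g"
  shows "g = h"
proof -
  have img: "g ` {1..n} = h ` {1..n}"
    using assms image_mono_idem[OF assms(1-3)] unfolding idem_rank_def
    by (intro card_seteq) auto
  have "g i = h i" for i
  proof (cases "i \<in> {1..n}")
    case True
    then have "g (h i) = h i" using img assms idem_fixed by blast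
    then show ?thesis using assms(1) by (simp add: idem_le_def)
  qed (use assms in \<open>simp add: idem_maps_def\<close>)
  then show ?thesis ..
qed

lemma idem_rank_less:
  "\<lbrakk>idem_le g h; h \<in> idem_maps n; g \<in> idem_maps n; g \<noteq> h\<rbrakk> \<Longrightarrow> idem_rank n g < idem_rank n h"
  using idem_le_rank_eq not_less by blast

lemma contract_in_idem_maps:
  assumes "h \<in> idem_maps n" "a \<in> h ` {1..n}" "b \<in> h ` {1..n}" "a \<noteq> b"
  shows "contract h a b \<in> idem_maps n"
  using assms(1,4) assms(2,3)[unfolded idem_fixed[OF assms(1)]]
  unfolding idem_maps_def contract_def by auto

lemma contract_image:
  assumes "h \<in> idem_maps n" "a \<in> h ` {1..n}" "b \<in> h ` {1..n}" "a \<noteq> b"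
  shows "contract h a b ` {1..n} = h ` {1..n} - {a}"
  using assms(2-4) unfolding contract_def by auto

lemma contract_rank:
  assumes "h \<in> idem_maps n" "a \<in> h ` {1..n}" "b \<in> h ` {1..n}" "a \<noteq> b"
  shows "idem_rank n h = Suc (idem_rank n (contract h a b))"
  unfolding idem_rank_def contract_image[OF assms] using assms(2)
  by (metis card.remove finite_atLeastAtMost finite_imageI)

text \<open>This reduces comparison with a lower cover to the values at two points: \<open>a\<close>
  and \<open>b\<close> get merged, and \<open>a\<close> does not survive as a point. All
  semimodularity checks go through this criterion.\<close>

lemma le_contract_iff:
  assumes "h \<in> idem_maps n" "a \<in> h ` {1..n}" "b \<in> h ` {1..n}" "a \<noteq> b" "w \<in> idem_maps n"
  shows "idem_le w (contract h a b) \<longleftrightarrow> idem_le w h \<and> w a = w b \<and> w a \<noteq> a"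
proof
  have fixed: "h a = a" "h b = b" using assms(1-3) idem_fixed by blast+
  assume w: "idem_le w (contract h a b)"
  have wu: "w (contract h a b i) = w i" "contract h a b (w i) = w i" for i
    using w unfolding idem_le_def by blast+
  have "w a = w b" using wu(1)[of a] fixed by (simp add: contract_def)
  moreover have "w a \<noteq> a"
    using wu(2)[of a] fixed \<open>a \<noteq> b\<close> by (auto simp: contract_def)
  moreover have "idem_le (contract h a b) h"
    using fixed assms(1) unfolding idem_le_def contract_def idem_maps_def by auto
  ultimately show "idem_le w h \<and> w a = w b \<and> w a \<noteq> a" using w idem_le_trans by blast
next
  assume w: "idem_le w h \<and> w a = w b \<and> w a \<noteq> a"
  have "w i \<noteq> a" for i using w assms(5) by (auto simp: idem_maps_def)
  then show "idem_le w (contract h a b)"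
    using w unfolding idem_le_def contract_def by auto
qed

lemma contract_lt:
  assumes "h \<in> idem_maps n" "a \<in> h ` {1..n}" "b \<in> h ` {1..n}" "a \<noteq> b"
  shows "idem_le (contract h a b) h \<and> contract h a b \<noteq> h"
proof -
  have "idem_le (contract h a b) (contract h a b)"
    by (rule idem_le_refl[OF contract_in_idem_maps[OF assms]])
  then have "idem_le (contract h a b) h"
    using le_contract_iff[OF assms contract_in_idem_maps[OF assms]] by blast
  moreover have "contract h a b \<noteq> h" using contract_rank[OF assms] by fastforce
  ultimately show ?thesis by blast
qed

text \<open>By rank some point \<open>a\<close> of \<open>h\<close> is lost in \<open>w\<close>;
  merging it into \<open>w a\<close>, the point of its new block, stays above
  \<open>w\<close>.\<close>

lemma lt_le_contract:
  assumes "h \<in> idem_maps n" "w \<in> idem_maps n" "idem_le w h" "w \<noteq> h"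
  obtains a b where "a \<in> h ` {1..n}" "b \<in> h ` {1..n}" "a \<noteq> b" "idem_le w (contract h a b)"
proof -
  have "w ` {1..n} \<noteq> h ` {1..n}"
    using idem_le_rank_eq[of w h n] assms by (auto simp: idem_rank_def)
  then obtain a where a: "a \<in> h ` {1..n}" "a \<notin> w ` {1..n}"
    using image_mono_idem[OF assms(3,1,2)] by blast
  have aw: "w a \<in> w ` {1..n}" "w a \<noteq> a" using a assms idem_fixed by blast+
  then have "w a \<in> h ` {1..n}" using image_mono_idem[OF assms(3,1,2)] by blast
  moreover have "w (w a) = w a" using assms(2) by (simp add: idem_maps_def)
  ultimately show thesis
    using that[of a "w a"] a aw le_contract_iff[of h n a "w a" w] assms by metis
qed

section \<open>Counting the idempotents below a given one\<close>

lemma finite_idem_maps: "finite (idem_maps n)"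
proof (rule inj_on_finite)
  show "inj_on (\<lambda>h. restrict h {1..n}) (idem_maps n)"
  proof (rule inj_onI, rule ext)
    fix g h i assume gh: "g \<in> idem_maps n" "h \<in> idem_maps n" "restrict g {1..n} = restrict h {1..n}"
    show "g i = h i"
    proof (cases "i \<in> {1..n}")
      case True
      then show ?thesis using fun_cong[OF gh(3), of i] by simp
    qed (use gh in \<open>simp add: idem_maps_def\<close>)
  qed
  show "(\<lambda>h. restrict h {1..n}) ` idem_maps n \<subseteq> {1..n} \<rightarrow>\<^sub>E {1..n}"
    by (auto simp: idem_maps_def)
  show "finite ({1..n} \<rightarrow>\<^sub>E {1..n})" by (intro finite_PiE) auto
qed

text \<open>Such a \<open>w\<close> fixes \<open>A\<close> and factors through \<open>y\<close>, so
  it amounts to a free choice of a value in \<open>A\<close> for each point of \<open>y\<close>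
  outside \<open>A\<close>.\<close>

lemma card_idem_maps_with_image:
  assumes y: "y \<in> idem_maps n" and A: "A \<subseteq> y ` {1..n}"
  shows "card {w \<in> idem_maps n. idem_le w y \<and> w ` {1..n} = A} = card A ^ (idem_rank n y - card A)"
proof -
  let ?D = "{w \<in> idem_maps n. idem_le w y \<and> w ` {1..n} = A}" and ?J = "y ` {1..n} - A"
  have fixA: "y i = i" "i \<in> {1..n}" if "i \<in> A" for i
    using that A idem_fixed[OF y] by auto
  have yin: "y i \<in> y ` {1..n}" if "i \<in> {1..n}" for i using that by blast
  \<comment> \<open>The inverse: precompose with \<open>y\<close>, fix the points in
    \<open>A\<close>, and use the chosen values elsewhere.\<close>
  let ?g = "\<lambda>g i. if i \<in> {1..n} then if y i \<in> A then y i else g (y i) else i"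
  have "bij_betw (\<lambda>w. restrict w ?J) ?D (?J \<rightarrow>\<^sub>E A)"
  proof (rule bij_betw_byWitness[where f' = ?g])
    show "\<forall>w\<in>?D. ?g (restrict w ?J) = w"
    proof (intro ballI ext)
      fix w i assume w: "w \<in> ?D"
      have "w i = w (y i)" using w by (simp add: idem_le_def)
      moreover have "w (y i) = y i" if "y i \<in> A" using w that idem_fixed[of w n "y i"] by blast
      moreover have "w i = i" if "i \<notin> {1..n}" using w that by (simp add: idem_maps_def)
      ultimately show "?g (restrict w ?J) i = w i" using yin by simp
    qed
    show "\<forall>g\<in>?J \<rightarrow>\<^sub>E A. restrict (?g g) ?J = g"
    proof (intro ballI ext)
      fix g i assume g: "g \<in> ?J \<rightarrow>\<^sub>E A"
      show "restrict (?g g) ?J i = g i"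
      proof (cases "i \<in> ?J")
        case True
        then have "i \<in> {1..n}" "y i = i" "i \<notin> A" using idem_fixed[OF y, of i] by blast+
        then show ?thesis using True by simp
      next
        case False
        have "g i = undefined" by (rule PiE_arb[OF g False])
        with False show ?thesis by (simp only: restrict_apply if_False)
      qed
    qed
    show "(\<lambda>w. restrict w ?J) ` ?D \<subseteq> ?J \<rightarrow>\<^sub>E A"
    proof
      fix g assume "g \<in> (\<lambda>w. restrict w ?J) ` ?D"
      then obtain w where w: "w ` {1..n} = A" "g = restrict w ?J" by blast
      have "w i \<in> A" if "i \<in> ?J" for i
        using that y unfolding w(1)[symmetric] idem_maps_def by blast
      then show "g \<in> ?J \<rightarrow>\<^sub>E A" unfolding w(2) by (intro restrict_PiE_iff[THEN iffD2]) blast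
    qed
    show "?g ` (?J \<rightarrow>\<^sub>E A) \<subseteq> ?D"
    proof
      fix h assume "h \<in> ?g ` (?J \<rightarrow>\<^sub>E A)"
      then obtain g where g: "g \<in> ?J \<rightarrow>\<^sub>E A" and h: "h = ?g g" by blast
      have hA: "h i \<in> A" if "i \<in> {1..n}" for i
        using that g yin[OF that] unfolding h by auto
      have hfix: "h i = i" if "i \<in> A" for i
        using fixA[OF that] that unfolding h by simp
      have hout: "h i = i" if "i \<notin> {1..n}" for i using that unfolding h by (simp only: if_False)
      have hy: "h (y i) = h i" for i
      proof (cases "i \<in> {1..n}")
        case True
        then have "y i \<in> {1..n}" "y (y i) = y i" using y unfolding idem_maps_def by blast+
        with True show ?thesis unfolding h by (simp only: if_True)
      next
        case False
        then show ?thesis using y by (simp add: idem_maps_def)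
      qed
      have "h (h i) = h i" for i
        using hA hfix hout by (cases "i \<in> {1..n}") simp_all
      then have "h \<in> idem_maps n"
        unfolding idem_maps_def using hA hout fixA(2) by blast
      moreover have "y (h i) = h i" for i
      proof (cases "i \<in> {1..n}")
        case True
        then show ?thesis by (intro fixA(1) hA)
      next
        case False
        then show ?thesis unfolding hout[OF False] using y unfolding idem_maps_def by blast
      qed
      moreover have "h ` {1..n} = A"
      proof
        show "h ` {1..n} \<subseteq> A" using hA by blast
        show "A \<subseteq> h ` {1..n}"
        proof
          fix j assume j: "j \<in> A"
          show "j \<in> h ` {1..n}" by (rule image_eqI[of _ _ j]) (use hfix[OF j] fixA(2)[OF j] in auto)
        qed
      qed
      ultimately show "h \<in> ?D" using hy by (simp add: idem_le_def)
    qed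
  qed
  then have "card ?D = card (?J \<rightarrow>\<^sub>E A)" by (rule bij_betw_same_card)
  also have "\<dots> = card A ^ card ?J" by (rule card_funcsetE) simp
  also have "card ?J = idem_rank n y - card A"
    unfolding idem_rank_def using A by (intro card_Diff_subset) (auto intro: finite_subset)
  finally show ?thesis .
qed

lemma card_idem_maps_below:
  assumes y: "y \<in> idem_maps n"
  shows "card {w \<in> idem_maps n. idem_le w y \<and> idem_rank n w = r}
    = (idem_rank n y choose r) * r ^ (idem_rank n y - r)"
proof -
  let ?A = "{A. A \<subseteq> y ` {1..n} \<and> card A = r}"
  have "{w \<in> idem_maps n. idem_le w y \<and> idem_rank n w = r}
      = (\<Union>A\<in>?A. {w \<in> idem_maps n. idem_le w y \<and> w ` {1..n} = A})"
    using image_mono_idem[OF _ y] by (auto simp: idem_rank_def)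
  then have "card {w \<in> idem_maps n. idem_le w y \<and> idem_rank n w = r}
      = card (\<Union>A\<in>?A. {w \<in> idem_maps n. idem_le w y \<and> w ` {1..n} = A})"
    by (rule arg_cong)
  also have "\<dots> = (\<Sum>A\<in>?A. card {w \<in> idem_maps n. idem_le w y \<and> w ` {1..n} = A})"
  proof (rule card_UN_disjoint)
    show "finite ?A" by simp
    show "\<forall>A\<in>?A. finite {w \<in> idem_maps n. idem_le w y \<and> w ` {1..n} = A}"
      using finite_idem_maps by simp
  qed blast
  also have "\<dots> = (\<Sum>A\<in>?A. r ^ (idem_rank n y - r))"
  proof (rule sum.cong[OF refl])
    fix A assume A: "A \<in> ?A"
    show "card {w \<in> idem_maps n. idem_le w y \<and> w ` {1..n} = A} = r ^ (idem_rank n y - r)"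
      using card_idem_maps_with_image[OF y, of A] A by (simp only: mem_Collect_eq)
  qed
  also have "\<dots> = (idem_rank n y choose r) * r ^ (idem_rank n y - r)"
    by (simp add: n_subsets idem_rank_def)
  finally show ?thesis .
qed

text \<open>The core of semimodularity. After \<open>a\<close> has been merged into
  \<open>b\<close>, merging \<open>c\<close> with \<open>d\<close> must be redone using points that
  survive in \<open>contract x a b\<close>, and the direction must be one that \<open>w\<close>
  tolerates.\<close>

lemma common_contract:
  assumes x: "x \<in> idem_maps n" and w: "w \<in> idem_maps n"
    and ab: "a \<in> x ` {1..n}" "b \<in> x ` {1..n}" "a \<noteq> b"
    and cd: "c \<in> x ` {1..n}" "d \<in> x ` {1..n}" "c \<noteq> d"
    and ne: "contract x a b \<noteq> contract x c d"
    and le: "idem_le w (contract x a b)" "idem_le w (contract x c d)"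
  obtains p q where "p \<in> contract x a b ` {1..n}" "q \<in> contract x a b ` {1..n}" "p \<noteq> q"
    "idem_le w (contract (contract x a b) p q)"
    "idem_le (contract (contract x a b) p q) (contract x c d)"
proof -
  note result = that
  let ?u = "contract x a b"
  note uI = contract_in_idem_maps[OF x ab] contract_image[OF x ab]
  have fx: "x a = a" "x b = b" "x c = c" "x d = d" using ab cd idem_fixed[OF x] by blast+
  have wle: "idem_le w x" "w a = w b" "w a \<noteq> a" "w c = w d" "w c \<noteq> c"
    using le le_contract_iff[OF x ab w] le_contract_iff[OF x cd w] by auto
  have wa: "w i \<noteq> a" "w i \<noteq> c" for i using wle w by (auto simp: idem_maps_def)
  \<comment> \<open>By \<open>le_contract_iff\<close> it is enough to find \<open>p\<close> and
    \<open>q\<close> that \<open>w\<close> merges, losing \<open>p\<close>, such that the new map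
    merges \<open>c\<close> with \<open>d\<close>, losing \<open>c\<close>.\<close>
  have main: thesis
    if pq: "p \<in> x ` {1..n} - {a}" "q \<in> x ` {1..n} - {a}" "p \<noteq> q" "w p = w q" "w p \<noteq> p"
      and z: "contract ?u p q c = contract ?u p q d" "contract ?u p q c \<noteq> c" for p q
  proof (rule result)
    show pq': "p \<in> ?u ` {1..n}" "q \<in> ?u ` {1..n}" "p \<noteq> q" using pq uI(2) by auto
    show "idem_le w (contract ?u p q)"
      using le(1) pq le_contract_iff[OF uI(1) pq' w] by blast
    have "idem_le (contract ?u p q) x"
      using contract_lt[OF uI(1) pq'] contract_lt[OF x ab] idem_le_trans by blast
    then show "idem_le (contract ?u p q) (contract x c d)"
      using z le_contract_iff[OF x cd contract_in_idem_maps[OF uI(1) pq']] by blast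
  qed
  show thesis
  proof (cases "a = c")
    case True
    then have bd: "b \<noteq> d" using ne by blast
    \<comment> \<open>The point \<open>a\<close> goes to \<open>b\<close> in one cover and to
      \<open>d\<close> in the other, so \<open>b\<close> and \<open>d\<close> must be merged. They
      are distinct with a common image under \<open>w\<close>, which can fix only one of them; the
      other is contracted.\<close>
    have "w b = w d" using wle True by simp
    then consider "w b \<noteq> b" | "w d \<noteq> d" using bd by metis
    then show ?thesis
    proof cases
      case 1
      show ?thesis
        by (rule main[of b d]) (use 1 ab cd bd fx True wle in \<open>simp_all add: contract_def\<close>)
    next
      case 2
      show ?thesis
        by (rule main[of d b]) (use 2 ab cd bd fx True wle in \<open>simp_all add: contract_def\<close>)
    qed
  next
    case False
    show ?thesis
    proof (cases "d = a")
      case False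
      show ?thesis
        by (rule main[of c d]) (use False \<open>a \<noteq> c\<close> ab cd fx wle in \<open>simp_all add: contract_def\<close>)
    next
      case d: True
      have u: "?u c = c" "?u d = b" using \<open>a \<noteq> c\<close> fx d by (simp_all add: contract_def)
      show ?thesis
      proof (cases "b = c")
        case False
        \<comment> \<open>The target \<open>d = a\<close> is gone and is represented by
          \<open>b\<close>, so \<open>c\<close> is contracted into \<open>b\<close> instead.\<close>
        have "w c = w b" using wle(2,4) d by simp
        moreover have "contract ?u c b c = b" "contract ?u c b d = b"
          using u False by (simp_all add: contract_def[of ?u])
        ultimately show ?thesis
          using ab(2,3) cd(1) \<open>a \<noteq> c\<close> False wle(5) by (intro main[of c b]) auto
      next
        case bc: True
        \<comment> \<open>The two covers merge the same pair but keep opposite points. Below both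
          neither point survives, so a third one is needed: \<open>w c\<close>, the point chosen by
          \<open>w\<close>.\<close>
        have "w c \<in> w ` {1..n}" using cd idem_fixed[OF x] by blast
        then have "w c \<in> x ` {1..n}" using image_mono_idem[OF wle(1) x w] by blast
        moreover have "w (w c) = w c" using w by (simp add: idem_maps_def)
        moreover have "contract ?u c (w c) c = w c" "contract ?u c (w c) d = w c"
          unfolding contract_def[of ?u] u using bc by simp_all
        ultimately show ?thesis
          using cd(1) \<open>a \<noteq> c\<close> wa[of c] by (intro main[of c "w c"]) simp_all
      qed
    qed
  qed
qed

section \<open>The semimodularity axioms for idempotents\<close>

lemma cover_eq_contract:
  assumes "h \<in> idem_maps n" "w \<in> idem_maps n" "strictly idem_le w h"
    and rank: "idem_rank n h = Suc (idem_rank n w)"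
  obtains a b where "a \<in> h ` {1..n}" "b \<in> h ` {1..n}" "a \<noteq> b" "w = contract h a b"
proof -
  obtain a b where ab: "a \<in> h ` {1..n}" "b \<in> h ` {1..n}" "a \<noteq> b" "idem_le w (contract h a b)"
    using lt_le_contract[of h n w] assms(1-3) unfolding strictly_def by blast
  moreover have "w = contract h a b"
    using idem_le_rank_eq[OF ab(4) contract_in_idem_maps[OF assms(1) ab(1-3)] assms(2)]
      contract_rank[OF assms(1) ab(1-3)] rank by simp
  ultimately show thesis using that by blast
qed

lemma abel_poset_idem_maps:
  assumes n: "1 \<le> n"
  shows "abel_poset (idem_maps n) (strictly idem_le) (idem_rank n)"
proof
  show "finite (idem_maps n)" by (rule finite_idem_maps)
  show "strictly idem_le x w" if "strictly idem_le x y" "strictly idem_le y w" for x y w :: "nat \<Rightarrow> nat"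
    using that idem_le_trans idem_le_antisym unfolding strictly_def by blast
  show "1 \<le> idem_rank n x" for x
    using n unfolding idem_rank_def by (simp add: Suc_le_eq card_gt_0_iff)
  show "idem_rank n x < idem_rank n y"
    if "x \<in> idem_maps n" "y \<in> idem_maps n" "strictly idem_le x y" for x y
    using that idem_rank_less unfolding strictly_def by blast
  show "\<exists>u\<in>idem_maps n. strictly idem_le u x \<and> idem_rank n x = Suc (idem_rank n u) \<and> (w = u \<or> strictly idem_le w u)"
    if w: "w \<in> idem_maps n" and x: "x \<in> idem_maps n" and lt: "strictly idem_le w x" for w x
  proof -
    obtain a b where ab: "a \<in> x ` {1..n}" "b \<in> x ` {1..n}" "a \<noteq> b" "idem_le w (contract x a b)"
      using lt_le_contract[of x n w] w x lt unfolding strictly_def by blast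
    then show ?thesis
      using contract_in_idem_maps[OF x ab(1-3)] contract_lt[OF x ab(1-3)] contract_rank[OF x ab(1-3)]
      unfolding strictly_def by blast
  qed
  show "\<exists>u\<in>idem_maps n. strictly idem_le u x" if x: "x \<in> idem_maps n" and rank: "1 < idem_rank n x" for x
  proof -
    have "\<not> card (x ` {1..n}) \<le> Suc 0" using rank by (simp add: idem_rank_def)
    then obtain a b where ab: "a \<in> x ` {1..n}" "b \<in> x ` {1..n}" "a \<noteq> b"
      unfolding card_le_Suc0_iff_eq[OF finite_imageI[OF finite_atLeastAtMost]] by blast
    then show ?thesis
      using contract_in_idem_maps[OF x ab] contract_lt[OF x ab] unfolding strictly_def by blast
  qed
  show "\<exists>z\<in>idem_maps n. strictly idem_le z u \<and> strictly idem_le z v \<and>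
      idem_rank n u = Suc (idem_rank n z) \<and> (w = z \<or> strictly idem_le w z)"
    if x: "x \<in> idem_maps n" and u: "u \<in> idem_maps n" and v: "v \<in> idem_maps n" and w: "w \<in> idem_maps n"
      and ne: "u \<noteq> v" and lt: "strictly idem_le u x" "strictly idem_le v x"
      and rank: "idem_rank n x = Suc (idem_rank n u)" "idem_rank n x = Suc (idem_rank n v)"
      and le: "w = u \<or> strictly idem_le w u" "w = v \<or> strictly idem_le w v"
    for x u v w
  proof -
    obtain a b where ab: "a \<in> x ` {1..n}" "b \<in> x ` {1..n}" "a \<noteq> b" and ueq: "u = contract x a b"
      using cover_eq_contract[OF x u lt(1) rank(1)] by blast
    obtain c d where cd: "c \<in> x ` {1..n}" "d \<in> x ` {1..n}" "c \<noteq> d" and veq: "v = contract x c d"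
      using cover_eq_contract[OF x v lt(2) rank(2)] by blast
    have wle: "idem_le w u" "idem_le w v"
      using le idem_le_refl[OF w] unfolding strictly_def by blast+
    obtain p q where pq: "p \<in> u ` {1..n}" "q \<in> u ` {1..n}" "p \<noteq> q"
      and z: "idem_le w (contract u p q)" "idem_le (contract u p q) v"
      using common_contract[OF x w ab cd] ne wle unfolding ueq veq by blast
    have "idem_rank n u = Suc (idem_rank n (contract u p q))" by (rule contract_rank[OF u pq])
    \<comment> \<open>The ranks of \<open>u\<close> and \<open>v\<close> agree, so a drop below
      \<open>u\<close> also makes the comparison with \<open>v\<close> strict.\<close>
    moreover from this have "contract u p q \<noteq> v" using rank by auto
    ultimately show ?thesis
      using contract_in_idem_maps[OF u pq] contract_lt[OF u pq] z unfolding strictly_def by blast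
  qed
  show "\<exists>w\<in>idem_maps n. (w = u \<or> strictly idem_le w u) \<and> (w = v \<or> strictly idem_le w v)"
    if x: "x \<in> idem_maps n" and u: "u \<in> idem_maps n" and v: "v \<in> idem_maps n"
      and lt: "strictly idem_le u x" "strictly idem_le v x"
      and rank: "idem_rank n x = Suc (idem_rank n u)" "idem_rank n x = Suc (idem_rank n v)" "2 < idem_rank n x"
    for x u v
  proof -
    obtain a b where ab: "a \<in> x ` {1..n}" "b \<in> x ` {1..n}" "a \<noteq> b" and ueq: "u = contract x a b"
      using cover_eq_contract[OF x u lt(1) rank(1)] by blast
    obtain c d where cd: "c \<in> x ` {1..n}" "d \<in> x ` {1..n}" "c \<noteq> d" and veq: "v = contract x c d"
      using cover_eq_contract[OF x v lt(2) rank(2)] by blast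
    have "\<not> x ` {1..n} \<subseteq> {a, c}"
    proof
      assume "x ` {1..n} \<subseteq> {a, c}"
      then have "idem_rank n x \<le> card {a, c}" unfolding idem_rank_def by (intro card_mono) auto
      also have "\<dots> \<le> 2" by (simp add: card_insert_if)
      finally show False using rank(3) by simp
    qed
    then obtain e where e: "e \<in> x ` {1..n}" "e \<noteq> a" "e \<noteq> c" by blast
    \<comment> \<open>Merging everything into \<open>e\<close> is allowed under both covers, since
      these lose only the points \<open>a\<close> and \<open>c\<close>. Rank above 2 supplies such
      an \<open>e\<close>.\<close>
    define w where "w i = (if i \<in> {1..n} then e else i)" for i
    have fixed: "e \<in> {1..n}" "x e = e" "a \<in> {1..n}" "b \<in> {1..n}" "c \<in> {1..n}" "d \<in> {1..n}"
      using e(1) ab cd idem_fixed[OF x] by blast+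
    have w: "w \<in> idem_maps n" using fixed(1) by (simp add: idem_maps_def w_def)
    have "idem_le w x"
    proof -
      have "x i \<in> {1..n} \<longleftrightarrow> i \<in> {1..n}" "i \<notin> {1..n} \<Longrightarrow> x i = i" for i
        using x unfolding idem_maps_def by (cases "i \<in> {1..n}"; force)+
      then show ?thesis using fixed(2) unfolding idem_le_def w_def by auto
    qed
    then have "idem_le w u" "idem_le w v"
      unfolding ueq veq le_contract_iff[OF x ab w] le_contract_iff[OF x cd w]
      using fixed e by (simp_all add: w_def)
    then show ?thesis using w unfolding strictly_def by blast
  qed
  show "card {w \<in> idem_maps n. (w = x \<or> strictly idem_le w x) \<and> idem_rank n w = r}
      = (idem_rank n x choose r) * r ^ (idem_rank n x - r)" if x: "x \<in> idem_maps n" for x r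
  proof -
    have "{w \<in> idem_maps n. (w = x \<or> strictly idem_le w x) \<and> idem_rank n w = r}
        = {w \<in> idem_maps n. idem_le w x \<and> idem_rank n w = r}"
      using idem_le_refl[OF x] by (auto simp: strictly_def)
    then show ?thesis using card_idem_maps_below[OF x] by simp
  qed
qed

section \<open>Subquotients of free modules\<close>

definition scale :: "'k::comm_ring_1 \<Rightarrow> ('s \<Rightarrow>\<^sub>0 'k) \<Rightarrow> ('s \<Rightarrow>\<^sub>0 'k)" where
  "scale a f = Poly_Mapping.map ((*) a) f"

lemma lookup_scale: "Poly_Mapping.lookup (scale a f) s = a * Poly_Mapping.lookup f s"
  by (simp add: scale_def Poly_Mapping.map.rep_eq when_def)

lemma scale_add: "scale a (f + g) = scale a f + scale a g"
  by (rule poly_mapping_eqI) (simp add: lookup_scale lookup_add algebra_simps)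

lemma scale_add_left: "scale (a + b) f = scale a f + scale b f"
  by (rule poly_mapping_eqI) (simp add: lookup_scale lookup_add algebra_simps)

lemma scale_scale: "scale (a * b) f = scale a (scale b f)"
  by (rule poly_mapping_eqI) (simp add: lookup_scale algebra_simps)

lemma scale_one: "scale 1 f = f"
  by (rule poly_mapping_eqI) (simp add: lookup_scale)

lemma scale_zero_left: "scale 0 f = 0"
  by (rule poly_mapping_eqI) (simp add: lookup_scale)

lemma scale_minus_one: "scale (- 1) f = - f"
  by (rule poly_mapping_eqI) (simp add: lookup_scale)

lemma scale_diff: "scale a (f - g) = scale a f - scale a g"
  by (rule poly_mapping_eqI) (simp add: lookup_scale lookup_minus algebra_simps)

locale subquotient =
  fixes S :: "'s set" and Z N :: "('s \<Rightarrow>\<^sub>0 'k::comm_ring_1) set"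
  assumes zero_N: "0 \<in> N" and N_sub: "N \<subseteq> Z"
    and add_N: "\<lbrakk>f \<in> N; g \<in> N\<rbrakk> \<Longrightarrow> f + g \<in> N" and scale_N: "f \<in> N \<Longrightarrow> scale a f \<in> N"
    and add_Z: "\<lbrakk>f \<in> Z; g \<in> Z\<rbrakk> \<Longrightarrow> f + g \<in> Z" and scale_Z: "f \<in> Z \<Longrightarrow> scale a f \<in> Z"
begin

definition quot :: "('k, ('s \<Rightarrow>\<^sub>0 'k) set) module" where
  "quot = quotient_module (free_module S \<lparr> carrier := Z \<rparr>) N"

definition cl :: "('s \<Rightarrow>\<^sub>0 'k) \<Rightarrow> ('s \<Rightarrow>\<^sub>0 'k) set" where
  "cl x = (\<lambda>h. h + x) ` N"

lemma diff_N: "\<lbrakk>f \<in> N; g \<in> N\<rbrakk> \<Longrightarrow> f - g \<in> N"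
  using add_N[of f "- g"] scale_N[of g "- 1"] by (simp add: scale_minus_one)

lemma cl_eq_iff: "cl x = cl y \<longleftrightarrow> x - y \<in> N"
proof
  assume "cl x = cl y"
  moreover have "x \<in> cl x" unfolding cl_def using zero_N by force
  ultimately have "x \<in> cl y" by simp
  then show "x - y \<in> N" by (auto simp: cl_def)
next
  assume xy: "x - y \<in> N"
  have "cl u \<subseteq> cl v" if "u - v \<in> N" for u v
  proof
    fix w assume "w \<in> cl u"
    then obtain h where h: "h \<in> N" "w = h + u" by (auto simp: cl_def)
    have "w = (h + (u - v)) + v" using h by simp
    then show "w \<in> cl v" unfolding cl_def using add_N[OF h(1) that] by blast
  qed
  moreover have "y - x \<in> N" using diff_N[OF zero_N xy] by simp
  ultimately show "cl x = cl y" using xy by blast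
qed

lemma cl_zero: "cl 0 = N"
  by (simp add: cl_def)

lemma coset_eq: "N +>\<^bsub>free_module S \<lparr> carrier := Z \<rparr>\<^esub> x = cl x"
  by (auto simp: a_r_coset_def' cl_def free_module_def)

lemma carrier_quot: "carrier quot = cl ` Z"
  by (auto simp: quot_def quotient_module_def A_RCOSETS_def' coset_eq)

lemma zero_quot: "\<zero>\<^bsub>quot\<^esub> = cl 0"
  by (simp add: quot_def quotient_module_def cl_zero)

lemma add_quot: "cl x \<oplus>\<^bsub>quot\<^esub> cl y = cl (x + y)"
proof -
  have "cl x \<oplus>\<^bsub>quot\<^esub> cl y = {h + k |h k. h \<in> cl x \<and> k \<in> cl y}"
    by (auto simp: quot_def quotient_module_def set_add_def' free_module_def)
  also have "\<dots> = cl (x + y)"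
  proof (rule subset_antisym; rule subsetI)
    fix w assume "w \<in> {h + k |h k. h \<in> cl x \<and> k \<in> cl y}"
    then obtain h k where "h \<in> N" "k \<in> N" "w = (h + x) + (k + y)" by (auto simp: cl_def)
    then have "w = (h + k) + (x + y)" "h + k \<in> N" by (auto simp: add_N algebra_simps)
    then show "w \<in> cl (x + y)" by (auto simp: cl_def)
  next
    fix w assume "w \<in> cl (x + y)"
    then obtain h where "h \<in> N" "w = (h + x) + (0 + y)" by (auto simp: cl_def algebra_simps)
    then show "w \<in> {h + k |h k. h \<in> cl x \<and> k \<in> cl y}" using zero_N unfolding cl_def by blast
  qed
  finally show ?thesis .
qed

lemma smult_quot: "a \<odot>\<^bsub>quot\<^esub> cl x = cl (scale a x)"
proof -
  have "a \<odot>\<^bsub>quot\<^esub> cl x = (\<Union>y\<in>cl x. N +>\<^bsub>free_module S \<lparr> carrier := Z \<rparr>\<^esub> scale a y)"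
    by (simp add: quot_def quotient_module_def free_module_def scale_def)
  also have "\<dots> = (\<Union>y\<in>cl x. cl (scale a y))" by (simp only: coset_eq)
  also have "\<dots> = (\<Union>y\<in>cl x. cl (scale a x))"
  proof (rule SUP_cong[OF refl])
    fix y assume "y \<in> cl x"
    then have "scale a (y - x) \<in> N" by (auto simp: cl_def intro: scale_N)
    then show "cl (scale a y) = cl (scale a x)" by (simp add: cl_eq_iff scale_diff)
  qed
  also have "\<dots> = cl (scale a x)" using zero_N by (auto simp: cl_def)
  finally show ?thesis .
qed

lemma abelian_group_quot: "abelian_group quot"
proof (rule abelian_groupI)
  show "\<exists>y\<in>carrier quot. y \<oplus>\<^bsub>quot\<^esub> x = \<zero>\<^bsub>quot\<^esub>" if x: "x \<in> carrier quot" for x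
  proof -
    obtain f where f: "f \<in> Z" "x = cl f" using x by (auto simp: carrier_quot)
    then have "cl (scale (- 1) f) \<in> carrier quot" by (simp add: carrier_quot scale_Z)
    moreover have "cl (scale (- 1) f) \<oplus>\<^bsub>quot\<^esub> x = \<zero>\<^bsub>quot\<^esub>"
      unfolding f add_quot zero_quot by (simp add: scale_minus_one)
    ultimately show ?thesis by blast
  qed
qed (use zero_N N_sub in \<open>auto simp: carrier_quot zero_quot add_quot add_Z algebra_simps\<close>)

lemma module_quot: "Module.module class_ring quot"
proof (rule moduleI)
  show "cring (class_ring :: 'k ring)" by (rule class_cring.cring_axioms)
  show "abelian_group quot" by (rule abelian_group_quot)
qed (auto simp: carrier_quot smult_quot add_quot scale_Z scale_add scale_add_left scale_scale scale_one)

text \<open>Linear combinations are indexed by sets of cosets, so representatives must not collide;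
  hence the injectivity hypothesis.\<close>

lemma lincomb_cl:
  assumes "finite A" "e ` A \<subseteq> Z" "inj_on (\<lambda>b. cl (e b)) A"
  shows "LinearCombinations.module.lincomb quot a ((\<lambda>b. cl (e b)) ` A)
    = cl (\<Sum>b\<in>A. scale (a (cl (e b))) (e b))"
proof -
  interpret Module.module class_ring quot by (rule module_quot)
  show ?thesis
    using assms
  proof (induction A rule: finite_induct)
    case empty
    show ?case by (simp add: lincomb_def zero_quot)
  next
    case (insert b A)
    have "cl (e b) \<notin> (\<lambda>b. cl (e b)) ` A" using insert.prems(2) insert.hyps(2) by auto
    then have "lincomb a ((\<lambda>b. cl (e b)) ` A \<union> {cl (e b)}) =
        a (cl (e b)) \<odot>\<^bsub>quot\<^esub> cl (e b) \<oplus>\<^bsub>quot\<^esub> lincomb a ((\<lambda>b. cl (e b)) ` A)"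
      using insert by (intro lincomb_insert) (auto simp: carrier_quot)
    also have "lincomb a ((\<lambda>b. cl (e b)) ` A) = cl (\<Sum>b\<in>A. scale (a (cl (e b))) (e b))"
      using insert by (intro insert.IH) auto
    finally show ?case using insert.hyps by (simp add: smult_quot add_quot)
  qed
qed

lemma free_of_rank_quot:
  assumes fin: "finite B" and e: "e ` B \<subseteq> Z"
    and spanning: "\<And>f. f \<in> Z \<Longrightarrow> \<exists>h. f - (\<Sum>b\<in>B. scale (h b) (e b)) \<in> N"
    and indep: "\<And>h b. \<lbrakk>(\<Sum>b\<in>B. scale (h b) (e b)) \<in> N; b \<in> B\<rbrakk> \<Longrightarrow> h b = 0"
  shows "free_of_rank class_ring quot (card B)"
proof -
  interpret Module.module class_ring quot by (rule module_quot)
  let ?v = "\<lambda>b. cl (e b)"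
  have inj: "inj_on ?v B"
  proof (rule inj_onI, rule ccontr)
    fix b c assume bc: "b \<in> B" "c \<in> B" "?v b = ?v c" "b \<noteq> c"
    \<comment> \<open>Equal classes would give a relation with coefficients 1 and -1, contradicting
      independence.\<close>
    define h where "h x = (if x = b then 1 else if x = c then - 1 else (0 :: 'k))" for x
    have "(\<Sum>x\<in>B. scale (h x) (e x)) = (\<Sum>x\<in>{b, c}. scale (h x) (e x))"
      using fin bc by (intro sum.mono_neutral_right) (auto simp: h_def scale_zero_left)
    also have "\<dots> = e b - e c" using bc by (simp add: h_def scale_one scale_minus_one)
    finally have "h b = 0" using bc by (intro indep[OF _ bc(1)]) (simp add: cl_eq_iff)
    then show False by (simp add: h_def)
  qed
  have "\<not> lin_dep (?v ` B)"
  proof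
    assume "lin_dep (?v ` B)"
    then obtain A a v where A: "finite A" "A \<subseteq> ?v ` B" "lincomb a A = \<zero>\<^bsub>quot\<^esub>" "v \<in> A" "a v \<noteq> 0"
      unfolding lin_dep_def by auto
    then obtain A0 where A0: "A0 \<subseteq> B" "A = ?v ` A0" by (meson subset_imageE)
    have finA0: "finite A0" using A0 fin by (auto intro: finite_subset)
    define h where "h b = (if b \<in> A0 then a (?v b) else 0)" for b
    have "cl (\<Sum>b\<in>A0. scale (a (?v b)) (e b)) = cl 0"
      using A(3) e A0 inj finA0 unfolding A0(2) zero_quot
      by (subst (asm) lincomb_cl) (auto intro: inj_on_subset)
    then have "(\<Sum>b\<in>A0. scale (a (?v b)) (e b)) \<in> N" by (simp add: cl_eq_iff)
    also have "(\<Sum>b\<in>A0. scale (a (?v b)) (e b)) = (\<Sum>b\<in>B. scale (h b) (e b))"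
      using A0 fin by (intro sum.mono_neutral_cong_left) (auto simp: h_def scale_zero_left)
    finally have h0: "h b = 0" if "b \<in> B" for b using that indep by blast
    obtain b where "b \<in> A0" "v = ?v b" using A(4) A0(2) by blast
    then show False using h0[of b] A(5) A0(1) by (auto simp: h_def)
  qed
  moreover have "span (?v ` B) = carrier quot"
  proof
    show "span (?v ` B) \<subseteq> carrier quot"
      using e by (intro span_is_subset2) (auto simp: carrier_quot)
    show "carrier quot \<subseteq> span (?v ` B)"
    proof
      fix x assume "x \<in> carrier quot"
      then obtain f where f: "f \<in> Z" "x = cl f" by (auto simp: carrier_quot)
      obtain h where h: "f - (\<Sum>b\<in>B. scale (h b) (e b)) \<in> N" using spanning[OF f(1)] by blast
      \<comment> \<open>Coefficients are wanted on cosets; injectivity allows moving them there from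
        \<open>B\<close>.\<close>
      define a where "a v = h (the_inv_into B ?v v)" for v
      have "a (?v b) = h b" if "b \<in> B" for b
        using the_inv_into_f_f[OF inj that] by (simp add: a_def)
      then have "lincomb a (?v ` B) = cl (\<Sum>b\<in>B. scale (h b) (e b))"
        using lincomb_cl[OF fin e inj, of a] by simp
      also have "\<dots> = x" using h diff_N[OF zero_N h] unfolding f(2) cl_eq_iff by simp
      finally show "x \<in> span (?v ` B)" unfolding span_def using fin by fastforce
    qed
  qed
  moreover have "card (?v ` B) = card B" using inj by (rule card_image)
  moreover have "?v ` B \<subseteq> carrier quot" using e by (auto simp: carrier_quot)
  ultimately show ?thesis
    unfolding free_of_rank_def using module_quot fin by blast
qed

end

section \<open>The cochain complex of a poset with a greatest element\<close>

text \<open>The bridge between the two forms of the differential: one inserts elements, the other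
  deletes them.\<close>

lemma insert_at_eq_iff:
  assumes "i \<le> length xs"
  shows "take i xs @ y # drop i xs = e \<longleftrightarrow> length e = Suc (length xs) \<and> e ! i = y \<and> del i e = xs"
proof
  assume e: "take i xs @ y # drop i xs = e"
  show "length e = Suc (length xs) \<and> e ! i = y \<and> del i e = xs"
    unfolding e[symmetric] using assms by (simp add: nth_append del_def)
next
  assume e: "length e = Suc (length xs) \<and> e ! i = y \<and> del i e = xs"
  then have i: "i < length e" using assms by simp
  have "take i (del i e) = take i e" "drop i (del i e) = drop (Suc i) e"
    using i by (simp_all add: del_def)
  then show "take i xs @ y # drop i xs = e" using e i by (metis id_take_nth_drop)
qed

locale top_poset =
  fixes P :: "'a set" and leq :: "'a \<Rightarrow> 'a \<Rightarrow> bool" and t :: 'a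
  assumes finite_P: "finite P" and t_in: "t \<in> P"
    and leq_top: "x \<in> P \<Longrightarrow> leq x t" and max_eq: "max_elements P leq = {t}"
    and lt_trans: "\<lbrakk>x \<in> P; y \<in> P; z \<in> P; strictly leq x y; strictly leq y z\<rbrakk> \<Longrightarrow> strictly leq x z"
begin

abbreviation "lt \<equiv> strictly leq"
abbreviation "Q \<equiv> P - {t}"

lemma max_chains_eq:
  "max_chains_of_length P leq k = (\<lambda>c. c @ [t]) ` {c \<in> strict_chains lt Q. length c = k}"
proof (intro Set.set_eqI iffI)
  fix e assume e: "e \<in> max_chains_of_length P leq k"
  then have "e \<noteq> []" "last e = t" by (auto simp: max_chains_of_length_def max_eq)
  then obtain c where c: "e = c @ [t]" by (metis append_butlast_last_id)
  have "c \<in> strict_chains lt Q" "length c = k"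
    using e unfolding c by (auto simp: max_chains_of_length_def strict_chains_def sorted_wrt_append strictly_def)
  then show "e \<in> (\<lambda>c. c @ [t]) ` {c \<in> strict_chains lt Q. length c = k}" using c by blast
next
  fix e assume "e \<in> (\<lambda>c. c @ [t]) ` {c \<in> strict_chains lt Q. length c = k}"
  then obtain c where "e = c @ [t]" "c \<in> strict_chains lt Q" "length c = k" by blast
  then show "e \<in> max_chains_of_length P leq k"
    using leq_top t_in
    by (auto simp: max_chains_of_length_def strict_chains_def sorted_wrt_append strictly_def max_eq)
qed

lemma snoc_max_chain_iff:
  "c @ [t] \<in> max_chains_of_length P leq k \<longleftrightarrow> c \<in> strict_chains lt Q \<and> length c = k"
  by (auto simp: max_chains_eq)

text \<open>Comparing \<open>y\<close> with its neighbours suffices by transitivity. For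
  \<open>i = 0\<close> there is no left neighbour, which accounts for the implication.\<close>

lemma insert_max_chain_iff:
  assumes xs: "xs \<in> max_chains_of_length P leq k" and i: "i < length xs"
  shows "(\<exists>y\<in>P. (0 < i \<longrightarrow> lt (xs ! (i - 1)) y) \<and> lt y (xs ! i) \<and> take i xs @ y # drop i xs = e)
    \<longleftrightarrow> e \<in> max_chains_of_length P leq (Suc k) \<and> del i e = xs" (is "?L \<longleftrightarrow> ?R")
proof
  assume ?L
  then obtain y where y: "y \<in> P" "0 < i \<Longrightarrow> lt (xs ! (i - 1)) y" "lt y (xs ! i)"
    and e: "take i xs @ y # drop i xs = e" by blast
  have xsD: "length xs = k + 1" "set xs \<subseteq> P" "sorted_wrt lt xs" "last xs = t"
    using xs by (auto simp: max_chains_of_length_def max_eq)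
  have split: "sorted_wrt lt (take i xs @ drop i xs)" using xsD by simp
  have "lt x y" if x: "x \<in> set (take i xs)" for x
  proof -
    obtain j where j: "j < i" "x = xs ! j" using x i by (auto simp: in_set_conv_nth)
    show ?thesis
    proof (cases "j = i - 1")
      case True
      then show ?thesis using j y(2) by simp
    next
      case False
      then have "lt x (xs ! (i - 1))" using xsD(3) j i by (simp add: sorted_wrt_iff_nth_less)
      moreover have "x \<in> P" "xs ! (i - 1) \<in> P" using xsD(2) i j by auto
      ultimately show ?thesis using lt_trans[of x "xs ! (i - 1)" y] y j by simp
    qed
  qed
  moreover have "lt y x" if x: "x \<in> set (drop i xs)" for x
  proof -
    have d: "drop i xs = xs ! i # drop (Suc i) xs" using i by (rule Cons_nth_drop_Suc[symmetric])
    have "sorted_wrt lt (drop i xs)" using xsD(3) by (rule sorted_wrt_drop)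
    then have "x = xs ! i \<or> lt (xs ! i) x" using x unfolding d by auto
    moreover have "x \<in> P" "xs ! i \<in> P" using xsD(2) i x by (auto dest: in_set_dropD)
    ultimately show ?thesis using lt_trans[of y "xs ! i" x] y by blast
  qed
  ultimately have "sorted_wrt lt e"
    using split[unfolded sorted_wrt_append] unfolding e[symmetric] sorted_wrt_append by simp
  moreover have "set e \<subseteq> P"
    using xsD(2) y(1) unfolding e[symmetric] by (auto dest: in_set_takeD in_set_dropD)
  moreover have "last e = t" using xsD(4) i unfolding e[symmetric] by (simp add: last_drop)
  moreover have "length e = Suc k + 1" "del i e = xs"
    using insert_at_eq_iff[of i xs y e] e i xsD(1) by auto
  ultimately show ?R by (simp add: max_chains_of_length_def max_eq)
next
  assume ?R
  then have eD: "length e = Suc (length xs)" "set e \<subseteq> P" "sorted_wrt lt e" "del i e = xs"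
    using xs by (auto simp: max_chains_of_length_def)
  have "xs ! (i - 1) = e ! (i - 1)" if "0 < i"
    using eD(1) i that unfolding eD(4)[symmetric] by (simp add: del_def nth_append)
  moreover have "xs ! i = e ! Suc i"
    using eD(1) i unfolding eD(4)[symmetric] by (simp add: del_def nth_append)
  moreover have "lt (e ! i) (e ! Suc i)" "0 < i \<Longrightarrow> lt (e ! (i - 1)) (e ! i)"
    using eD(1,3) i by (simp_all add: sorted_wrt_iff_nth_less)
  moreover have "e ! i \<in> P" using eD(1,2) i by auto
  moreover have "take i xs @ e ! i # drop i xs = e"
    using insert_at_eq_iff[of i xs "e ! i" e] eD i by simp
  ultimately show ?L by (intro bexI[of _ "e ! i"]) simp_all
qed

lemma lookup_chain_differential:
  assumes xs: "xs \<in> max_chains_of_length P leq k"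
  shows "Poly_Mapping.lookup (chain_differential P leq xs :: 'a list \<Rightarrow>\<^sub>0 'k::comm_ring_1) e =
    (if e \<in> max_chains_of_length P leq (Suc k) then \<Sum>i\<le>k. if del i e = xs then (- 1) ^ i else 0 else 0)"
proof -
  have len: "length xs = Suc k" using xs by (simp add: max_chains_of_length_def)
  \<comment> \<open>With this convention the leading sum of the differential is just the term
    \<open>i = 0\<close>.\<close>
  define Y where "Y i = {y \<in> P. (0 < i \<longrightarrow> lt (xs ! (i - 1)) y) \<and> lt y (xs ! i)}" for i
  have fin: "finite (Y i)" for i using finite_P by (simp add: Y_def)
  have hd: "hd xs = xs ! 0" using len by (intro hd_conv_nth) auto
  have "(chain_differential P leq xs :: 'a list \<Rightarrow>\<^sub>0 'k) =
      (\<Sum>y\<in>Y 0. Poly_Mapping.single (take 0 xs @ y # drop 0 xs) ((- 1) ^ 0)) +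
      (\<Sum>i=1..<length xs. \<Sum>y\<in>Y i. Poly_Mapping.single (take i xs @ y # drop i xs) ((- 1) ^ i))"
    unfolding chain_differential_def Y_def hd by (intro arg_cong2[of _ _ _ _ "(+)"] sum.cong) auto
  also have "\<dots> = (\<Sum>i\<le>k. \<Sum>y\<in>Y i. Poly_Mapping.single (take i xs @ y # drop i xs) ((- 1) ^ i))"
  proof -
    have "{..k} = insert 0 {1..<length xs}" using len by auto
    then show ?thesis by simp
  qed
  finally have "Poly_Mapping.lookup (chain_differential P leq xs :: 'a list \<Rightarrow>\<^sub>0 'k) e =
      (\<Sum>i\<le>k. \<Sum>y\<in>Y i. if take i xs @ y # drop i xs = e then (- 1) ^ i else 0)"
    by (simp add: lookup_sum lookup_single when_def)
  also have "\<dots> = (\<Sum>i\<le>k. if e \<in> max_chains_of_length P leq (Suc k) \<and> del i e = xs then (- 1) ^ i else 0)"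
  proof (rule sum.cong[OF refl])
    fix i assume "i \<in> {..k}"
    then have i: "i < length xs" using len by simp
    have "(\<Sum>y\<in>Y i. if take i xs @ y # drop i xs = e then (- 1) ^ i else (0 :: 'k))
        = (if \<exists>y\<in>Y i. take i xs @ y # drop i xs = e then (- 1) ^ i else 0)"
    proof (cases "\<exists>y\<in>Y i. take i xs @ y # drop i xs = e")
      case True
      then obtain y where y: "y \<in> Y i" "take i xs @ y # drop i xs = e" by blast
      have "take i xs @ z # drop i xs = e \<longleftrightarrow> z = y" for z using y(2) by auto
      then show ?thesis using y(1) fin[of i] True by simp
    qed auto
    also have "(\<exists>y\<in>Y i. take i xs @ y # drop i xs = e)
        \<longleftrightarrow> e \<in> max_chains_of_length P leq (Suc k) \<and> del i e = xs"
      unfolding insert_max_chain_iff[OF xs i, symmetric] Y_def by blast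
    finally show "(\<Sum>y\<in>Y i. if take i xs @ y # drop i xs = e then (- 1) ^ i else (0 :: 'k))
        = (if e \<in> max_chains_of_length P leq (Suc k) \<and> del i e = xs then (- 1) ^ i else 0)" .
  qed
  finally show ?thesis by simp
qed

lemma lookup_differential:
  fixes f :: "'a list \<Rightarrow>\<^sub>0 'k::comm_ring_1"
  assumes f: "Poly_Mapping.keys f \<subseteq> max_chains_of_length P leq k"
  shows "Poly_Mapping.lookup (differential P leq f) e =
    (if e \<in> max_chains_of_length P leq (Suc k) then \<Sum>i\<le>k. (- 1) ^ i * Poly_Mapping.lookup f (del i e) else 0)"
proof -
  have "Poly_Mapping.lookup (differential P leq f) e =
      (\<Sum>xs\<in>Poly_Mapping.keys f. Poly_Mapping.lookup f xs *
        (if e \<in> max_chains_of_length P leq (Suc k) then \<Sum>i\<le>k. if del i e = xs then (- 1) ^ i else 0 else 0))"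
    unfolding differential_def scale_def[symmetric] lookup_sum lookup_scale
    using f by (intro sum.cong refl) (auto simp: lookup_chain_differential)
  also have "\<dots> = (if e \<in> max_chains_of_length P leq (Suc k) then
      \<Sum>i\<le>k. \<Sum>xs\<in>Poly_Mapping.keys f. (if del i e = xs then Poly_Mapping.lookup f xs * (- 1) ^ i else 0) else 0)"
    by (subst sum.swap) (auto simp: sum_distrib_left intro!: sum.cong)
  also have "\<dots> = (if e \<in> max_chains_of_length P leq (Suc k) then
      \<Sum>i\<le>k. (- 1) ^ i * Poly_Mapping.lookup f (del i e) else 0)"
    by (intro if_cong sum.cong refl) (simp add: sum.delta in_keys_iff)
  finally show ?thesis .
qed

section \<open>Passage to functions on the chains below the greatest element\<close>

abbreviation pull :: "('a list \<Rightarrow>\<^sub>0 'k::comm_ring_1) \<Rightarrow> 'a list \<Rightarrow> 'k" where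
  "pull f c \<equiv> Poly_Mapping.lookup f (c @ [t])"

lemma carrier_cochains: "carrier (cochains P leq k) = {f. Poly_Mapping.keys f \<subseteq> max_chains_of_length P leq k}"
  by (simp add: cochains_def free_module_def)

lemma lookup_outside:
  assumes "f \<in> carrier (cochains P leq k)" "e \<notin> max_chains_of_length P leq k"
  shows "Poly_Mapping.lookup f e = 0"
  using assms unfolding carrier_cochains by (auto simp: in_keys_iff)

lemma cochain_eqI:
  assumes "f \<in> carrier (cochains P leq k)" "g \<in> carrier (cochains P leq k)"
    and "\<And>c. c \<in> strict_chains lt Q \<Longrightarrow> length c = k \<Longrightarrow> pull f c = pull g c"
  shows "f = g"
proof (rule poly_mapping_eqI)
  fix e
  show "Poly_Mapping.lookup f e = Poly_Mapping.lookup g e"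
  proof (cases "e \<in> max_chains_of_length P leq k")
    case True
    then obtain c where "e = c @ [t]" "c \<in> strict_chains lt Q" "length c = k"
      unfolding max_chains_eq by blast
    then show ?thesis using assms(3) by simp
  next
    case False
    then show ?thesis using lookup_outside assms(1,2) by metis
  qed
qed

lemma differential_in_cochains:
  assumes "f \<in> carrier (cochains P leq k)"
  shows "differential P leq f \<in> carrier (cochains P leq (Suc k))"
  using assms unfolding carrier_cochains
  by (auto simp: in_keys_iff lookup_differential split: if_splits)

text \<open>\<open>pull\<close> is a map of complexes. Deleting an element of \<open>c\<close>
  leaves \<open>t\<close> in place; in lengths other than \<open>Suc k\<close> both sides vanish
  because \<open>f\<close> lives in a single degree.\<close>

lemma pull_differential:
  fixes f :: "'a list \<Rightarrow>\<^sub>0 'k::comm_ring_1"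
  assumes f: "f \<in> carrier (cochains P leq k)" and c: "c \<in> strict_chains lt Q"
  shows "pull (differential P leq f) c = coboundary (pull f) c"
proof (cases "length c = Suc k")
  case True
  then have "c @ [t] \<in> max_chains_of_length P leq (Suc k)" using c by (simp add: snoc_max_chain_iff)
  moreover have "{..k} = {..<length c}" using True by auto
  ultimately show ?thesis
    using f by (simp add: carrier_cochains lookup_differential coboundary_def del_append)
next
  case False
  then have "c @ [t] \<notin> max_chains_of_length P leq (Suc k)" by (simp add: snoc_max_chain_iff)
  moreover have "coboundary (pull f) c = 0"
    using False by (intro coboundary_zero lookup_outside[OF f]) (auto simp: snoc_max_chain_iff length_del)
  ultimately show ?thesis using f by (simp add: carrier_cochains lookup_differential)
qed

lemma add_cochains:
  "f \<in> carrier (cochains P leq k) \<Longrightarrow> g \<in> carrier (cochains P leq k) \<Longrightarrow> f + g \<in> carrier (cochains P leq k)"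
  unfolding carrier_cochains using keys_add[of f g] by blast

lemma scale_cochains: "f \<in> carrier (cochains P leq k) \<Longrightarrow> scale a f \<in> carrier (cochains P leq k)"
  unfolding carrier_cochains
  by (rule CollectI, rule subset_trans[of _ "Poly_Mapping.keys f"]) (auto simp: in_keys_iff lookup_scale)

lemma differential_add:
  assumes "f \<in> carrier (cochains P leq k)" "g \<in> carrier (cochains P leq k)"
  shows "differential P leq (f + g) = differential P leq f + differential P leq g"
  using assms add_cochains[OF assms] unfolding carrier_cochains
  by (intro poly_mapping_eqI)
    (simp add: lookup_differential lookup_add sum.distrib algebra_simps)

lemma differential_scale:
  assumes "f \<in> carrier (cochains P leq k)"
  shows "differential P leq (scale a f) = scale a (differential P leq f)"
  using assms scale_cochains[OF assms, of a] unfolding carrier_cochains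
  by (intro poly_mapping_eqI)
    (simp add: lookup_differential lookup_scale sum_distrib_left mult_ac)

lemma zero_cochains: "0 \<in> carrier (cochains P leq k)"
  by (simp add: carrier_cochains)

lemma coboundaries_in_cochains:
  "f \<in> coboundaries P leq k \<Longrightarrow> f \<in> carrier (cochains P leq k)"
  by (cases k) (auto simp: coboundaries_def zero_cochains intro: differential_in_cochains)

lemma coboundaryD:
  fixes u :: "'a list \<Rightarrow>\<^sub>0 'k::comm_ring_1"
  assumes "u \<in> coboundaries P leq k"
  obtains g where "\<And>c. c \<in> strict_chains lt Q \<Longrightarrow> pull u c = coboundary g c"
proof (cases k)
  case 0
  then have "u = 0" using assms by (simp add: coboundaries_def)
  then show thesis using that[of "\<lambda>_. 0"] by (simp add: coboundary_def)
next
  case (Suc m)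
  then obtain f where "f \<in> carrier (cochains P leq m)" "u = differential P leq f"
    using assms by (auto simp: coboundaries_def)
  then show thesis using that pull_differential by blast
qed

text \<open>An arbitrary function \<open>g\<close> may serve as primitive: only its values on chains
  with one element less matter, so it can be truncated to them. In degree 0 the condition forces
  \<open>u = 0\<close>.\<close>

lemma coboundaryI:
  fixes u :: "'a list \<Rightarrow>\<^sub>0 'k::comm_ring_1"
  assumes u: "u \<in> carrier (cochains P leq k)"
    and g: "\<And>c. c \<in> strict_chains lt Q \<Longrightarrow> length c = k \<Longrightarrow> pull u c = coboundary g c"
  shows "u \<in> coboundaries P leq k"
proof (cases k)
  case 0
  have "u = 0" using g 0 by (intro cochain_eqI[OF u zero_cochains]) simp
  then show ?thesis using 0 by (simp add: coboundaries_def)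
next
  case (Suc m)
  let ?C = "{c \<in> strict_chains lt Q. length c = m}"
  define f where "f = (\<Sum>c\<in>?C. Poly_Mapping.single (c @ [t]) (g c))"
  have fin: "finite ?C"
    using finite_P finite_chains[of Q lt] by (simp add: strictly_def)
  have f_lookup: "Poly_Mapping.lookup f e = (\<Sum>c\<in>?C. g c when c @ [t] = e)" for e
    by (simp add: f_def lookup_sum lookup_single)
  have pull_f: "pull f c = g c" if "c \<in> strict_chains lt Q" "length c = m" for c
  proof -
    have "pull f c = (\<Sum>d\<in>?C. if d = c then g d else 0)"
      unfolding f_lookup by (intro sum.cong) (auto simp: when_def)
    then show ?thesis using that fin by simp
  qed
  have "Poly_Mapping.lookup f e = 0" if "e \<notin> max_chains_of_length P leq m" for e
    unfolding f_lookup using that by (intro sum.neutral) (auto simp: max_chains_eq when_def)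
  then have f: "f \<in> carrier (cochains P leq m)"
    unfolding carrier_cochains by (auto simp: in_keys_iff)
  have "u = differential P leq f"
  proof (rule cochain_eqI[OF u])
    show "differential P leq f \<in> carrier (cochains P leq k)"
      unfolding Suc by (rule differential_in_cochains[OF f])
    fix c assume c: "c \<in> strict_chains lt Q" "length c = k"
    have "coboundary g c = coboundary (pull f) c"
    proof (rule coboundary_cong)
      fix i assume "i < length c"
      then show "g (del i c) = pull f (del i c)"
        using c Suc by (intro pull_f[symmetric] del_in_chains) (simp_all add: length_del)
    qed
    then show "pull u c = pull (differential P leq f) c"
      using g[OF c] pull_differential[OF f c(1)] by simp
  qed
  then show ?thesis using f Suc by (simp add: coboundaries_def)
qed

lemma cocycle_iff:
  fixes u :: "'a list \<Rightarrow>\<^sub>0 'k::comm_ring_1"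
  shows "u \<in> cocycles P leq k \<longleftrightarrow> u \<in> carrier (cochains P leq k) \<and> (\<forall>c\<in>strict_chains lt Q. coboundary (pull u) c = 0)"
proof
  assume "u \<in> cocycles P leq k"
  then have u: "u \<in> carrier (cochains P leq k)" "differential P leq u = 0" by (simp_all add: cocycles_def)
  then show "u \<in> carrier (cochains P leq k) \<and> (\<forall>c\<in>strict_chains lt Q. coboundary (pull u) c = 0)"
    using pull_differential[OF u(1)] by simp
next
  assume u: "u \<in> carrier (cochains P leq k) \<and> (\<forall>c\<in>strict_chains lt Q. coboundary (pull u) c = 0)"
  then have "differential P leq u = 0"
    using pull_differential[of u k] zero_cochains[of "Suc k"] differential_in_cochains[of u k]
    by (intro cochain_eqI) auto
  then show "u \<in> cocycles P leq k" using u by (simp add: cocycles_def)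
qed

lemma coboundaries_subset_cocycles: "coboundaries P leq k \<subseteq> cocycles P leq k"
proof
  fix u assume u: "u \<in> coboundaries P leq k"
  then obtain g where g: "\<And>c. c \<in> strict_chains lt Q \<Longrightarrow> pull u c = coboundary g c"
    by (rule coboundaryD) blast
  have "coboundary (pull u) c = 0" if c: "c \<in> strict_chains lt Q" for c
  proof -
    have "coboundary (pull u) c = coboundary (coboundary g) c"
      using c by (intro coboundary_cong g del_in_chains)
    then show ?thesis by (simp add: coboundary_coboundary)
  qed
  then show "u \<in> cocycles P leq k" using coboundaries_in_cochains[OF u] by (simp add: cocycle_iff)
qed

lemma subquotient_cohomology:
  "subquotient (cocycles P leq k) (coboundaries P leq k :: ('a list \<Rightarrow>\<^sub>0 'k::comm_ring_1) set)"
proof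
  show "coboundaries P leq k \<subseteq> cocycles P leq k" by (rule coboundaries_subset_cocycles)
  show "0 \<in> coboundaries P leq k"
    by (rule coboundaryI[OF zero_cochains, of _ "\<lambda>_. 0"]) (simp add: coboundary_def)
  show "f + g \<in> cocycles P leq k" if "f \<in> cocycles P leq k" "g \<in> cocycles P leq k" for f g :: "'a list \<Rightarrow>\<^sub>0 'k"
    using that add_cochains[of f k g] differential_add[of f k g] by (simp add: cocycles_def)
  show "scale a f \<in> cocycles P leq k" if "f \<in> cocycles P leq k" for a :: 'k and f
    using that scale_cochains[of f k a] differential_scale[of f k a]
    by (simp add: cocycles_def) (rule poly_mapping_eqI, simp add: lookup_scale)
  show "f + g \<in> coboundaries P leq k" if fg: "f \<in> coboundaries P leq k" "g \<in> coboundaries P leq k"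
    for f g :: "'a list \<Rightarrow>\<^sub>0 'k"
  proof -
    obtain u where u: "\<And>c. c \<in> strict_chains lt Q \<Longrightarrow> pull f c = coboundary u c"
      using fg(1) by (rule coboundaryD) blast
    obtain v where v: "\<And>c. c \<in> strict_chains lt Q \<Longrightarrow> pull g c = coboundary v c"
      using fg(2) by (rule coboundaryD) blast
    show ?thesis
      using add_cochains[OF fg[THEN coboundaries_in_cochains]] u v
      by (intro coboundaryI[where g = "\<lambda>c. u c + v c"]) (simp_all add: lookup_add coboundary_add)
  qed
  show "scale a f \<in> coboundaries P leq k" if f: "f \<in> coboundaries P leq k" for a :: 'k and f
  proof -
    obtain u where u: "\<And>c. c \<in> strict_chains lt Q \<Longrightarrow> pull f c = coboundary u c"
      using f by (rule coboundaryD) blast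
    show ?thesis
      using scale_cochains[OF coboundaries_in_cochains[OF f]] u
      by (intro coboundaryI[where g = "\<lambda>c. a * u c"])
        (simp_all add: lookup_scale coboundary_def sum_distrib_left mult_ac)
  qed
qed

text \<open>The correction term \<open>h\<close> is supported on chains of length \<open>d\<close>,
  so in any other degree it disappears and every cocycle is a coboundary. In degree \<open>d\<close>
  it gives the coordinates of a class.\<close>

theorem cohomology_spherical:
  assumes sph: "spherical (K :: 'k::comm_ring_1 itself) lt Q d B"
  shows "k \<noteq> d \<Longrightarrow> carrier (cohomology P leq k :: ('k, _) module) = {\<zero>\<^bsub>cohomology P leq k\<^esub>}"
    and "free_of_rank class_ring (cohomology P leq d :: ('k, _) module) (card B)"
proof -
  assume k: "k \<noteq> d"
  interpret subquotient "max_chains_of_length P leq k" "cocycles P leq k"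
      "coboundaries P leq k :: ('a list \<Rightarrow>\<^sub>0 'k) set"
    by (rule subquotient_cohomology)
  have eq: "quot = cohomology P leq k" by (simp add: quot_def cohomology_def cochains_def)
  have "f \<in> coboundaries P leq k" if f: "f \<in> cocycles P leq k" for f :: "'a list \<Rightarrow>\<^sub>0 'k"
  proof -
    have cocycle: "coboundary (pull f) c = 0" if "c \<in> strict_chains lt Q" for c
      using f that by (simp add: cocycle_iff)
    obtain g h where h: "\<And>c. c \<notin> B \<Longrightarrow> h c = 0"
      and gh: "\<And>c. c \<in> strict_chains lt Q \<Longrightarrow> pull f c = coboundary g c + h c"
      by (rule spherical_split[OF sph cocycle], assumption, rule that)
    show ?thesis
    proof (rule coboundaryI)
      show "f \<in> carrier (cochains P leq k)" using f by (simp add: cocycles_def)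
      fix c assume c: "c \<in> strict_chains lt Q" "length c = k"
      then have "c \<notin> B" using k sphericalD(4)[OF sph] by blast
      then show "pull f c = coboundary g c" using gh[OF c(1)] h by simp
    qed
  qed
  then have "cl f = cl 0" if "f \<in> cocycles P leq k" for f using that by (simp add: cl_eq_iff)
  moreover have "(0 :: 'a list \<Rightarrow>\<^sub>0 'k) \<in> cocycles P leq k" using zero_N N_sub by blast
  ultimately have "carrier quot = {\<zero>\<^bsub>quot\<^esub>}"
    unfolding carrier_quot zero_quot by blast
  then show "carrier (cohomology P leq k :: ('k, _) module) = {\<zero>\<^bsub>cohomology P leq k\<^esub>}"
    unfolding eq .
next
  interpret subquotient "max_chains_of_length P leq d" "cocycles P leq d"
      "coboundaries P leq d :: ('a list \<Rightarrow>\<^sub>0 'k) set"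
    by (rule subquotient_cohomology)
  have eq: "quot = cohomology P leq d" by (simp add: quot_def cohomology_def cochains_def)
  note fin = sphericalD(2)[OF sph] and B_chain = sphericalD(3)[OF sph] and B_len = sphericalD(4)[OF sph]
  define e :: "'a list \<Rightarrow> ('a list \<Rightarrow>\<^sub>0 'k)" where "e b = Poly_Mapping.single (b @ [t]) 1" for b
  have e_cochain: "e b \<in> carrier (cochains P leq d)" if "b \<in> B" for b
    using B_chain[OF that] B_len[OF that]
    by (simp add: carrier_cochains e_def snoc_max_chain_iff)
  \<comment> \<open>No chain of \<open>Q\<close> has more than \<open>d\<close> elements, so there
    is nothing above degree \<open>d\<close> to map to.\<close>
  have top_cocycle: "u \<in> cocycles P leq d" if "u \<in> carrier (cochains P leq d)" for u :: "'a list \<Rightarrow>\<^sub>0 'k"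
  proof -
    have "coboundary (pull u) c = 0" if "c \<in> strict_chains lt Q" for c
    proof (rule coboundary_zero)
      fix i assume "i < length c"
      then have "length (del i c) \<noteq> d" using sphericalD(1)[OF sph that] by (simp add: length_del)
      then show "pull u (del i c) = 0"
        using \<open>u \<in> carrier (cochains P leq d)\<close> by (intro lookup_outside) (auto simp: snoc_max_chain_iff)
    qed
    then show ?thesis using that by (simp add: cocycle_iff)
  qed
  have pull_sum: "pull (\<Sum>b\<in>B. scale (h b) (e b)) c = (if c \<in> B then h c else 0)" for h c
  proof -
    have "pull (\<Sum>b\<in>B. scale (h b) (e b)) c = (\<Sum>b\<in>B. if b = c then h b else 0)"
      unfolding lookup_sum by (intro sum.cong) (auto simp: lookup_scale e_def lookup_single when_def)
    then show ?thesis using fin by simp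
  qed
  have sum_cochain: "(\<Sum>b\<in>B. scale (h b) (e b)) \<in> carrier (cochains P leq d)" for h
    using fin e_cochain B_chain
  proof (induction B rule: finite_induct)
    case (insert b B)
    then show ?case by (simp add: add_cochains scale_cochains)
  qed (simp add: zero_cochains)
  have "free_of_rank class_ring quot (card B)"
  proof (rule free_of_rank_quot[OF fin])
    show "e ` B \<subseteq> cocycles P leq d" using e_cochain top_cocycle by blast
    show "\<exists>h. f - (\<Sum>b\<in>B. scale (h b) (e b)) \<in> coboundaries P leq d"
      if f: "f \<in> cocycles P leq d" for f
    proof -
      have cocycle: "coboundary (pull f) c = 0" if "c \<in> strict_chains lt Q" for c
      using f that by (simp add: cocycle_iff)
    obtain g h where h: "\<And>c. c \<notin> B \<Longrightarrow> h c = 0"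
        and gh: "\<And>c. c \<in> strict_chains lt Q \<Longrightarrow> pull f c = coboundary g c + h c"
        by (rule spherical_split[OF sph cocycle], assumption, rule that)
      have "f \<in> carrier (cochains P leq d)" using f by (simp add: cocycles_def)
      then have "f + scale (- 1) (\<Sum>b\<in>B. scale (h b) (e b)) \<in> carrier (cochains P leq d)"
        by (intro add_cochains scale_cochains sum_cochain)
      then have "f - (\<Sum>b\<in>B. scale (h b) (e b)) \<in> coboundaries P leq d"
        by (intro coboundaryI[where g = g]) (simp_all add: scale_minus_one lookup_minus pull_sum gh h)
      then show ?thesis by blast
    qed
    show "h b = 0" if h: "(\<Sum>b\<in>B. scale (h b) (e b)) \<in> coboundaries P leq d" and b: "b \<in> B" for h b
    proof -
      obtain g where g: "\<And>c. c \<in> strict_chains lt Q \<Longrightarrow> (if c \<in> B then h c else 0) = coboundary g c"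
        using coboundaryD[OF h] unfolding pull_sum by blast
      have "(if b \<in> B then h b else 0) = 0"
        by (rule sphericalD(6)[OF sph, where h = "\<lambda>c. if c \<in> B then h c else 0", OF _ g[symmetric]]) auto
      then show ?thesis using b by simp
    qed
  qed
  then show "free_of_rank class_ring (cohomology P leq d :: ('k, _) module) (card B)"
    unfolding eq .
qed

end

section \<open>Pointed partitions\<close>

text \<open>The axioms speak only of order and rank, so they pass along an injection that preserves
  and reflects the strict order.\<close>

lemma abel_poset_pullback:
  assumes "abel_poset (\<phi> ` X) lt rk" and inj: "inj_on \<phi> X"
    and lt': "\<And>x y. x \<in> X \<Longrightarrow> y \<in> X \<Longrightarrow> lt' x y \<longleftrightarrow> lt (\<phi> x) (\<phi> y)"
  shows "abel_poset X lt' (\<lambda>x. rk (\<phi> x))"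
proof -
  interpret abel_poset "\<phi> ` X" lt rk by (rule assms(1))
  have eq: "x = y \<longleftrightarrow> \<phi> x = \<phi> y" if "x \<in> X" "y \<in> X" for x y
    using that inj by (auto dest: inj_onD)
  show ?thesis
  proof
    show "finite X" using finite_P inj by (rule finite_imageD)
    show "lt' x w" if "x \<in> X" "y \<in> X" "w \<in> X" "lt' x y" "lt' y w" for x y w
      using that lt' lt_trans[of "\<phi> x" "\<phi> y" "\<phi> w"] by simp
    show "1 \<le> rk (\<phi> x)" if "x \<in> X" for x using that rk_pos by blast
    show "rk (\<phi> x) < rk (\<phi> y)" if "x \<in> X" "y \<in> X" "lt' x y" for x y
      using that lt' rk_less by blast
    show "\<exists>u\<in>X. lt' u x \<and> rk (\<phi> x) = Suc (rk (\<phi> u)) \<and> (w = u \<or> lt' w u)"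
      if "w \<in> X" "x \<in> X" "lt' w x" for w x
      using cover_between[of "\<phi> w" "\<phi> x"] that lt' eq by (simp cong: bex_cong)
    show "\<exists>u\<in>X. lt' u x" if "x \<in> X" "1 < rk (\<phi> x)" for x
      using not_minimal[of "\<phi> x"] that lt' by (simp cong: bex_cong)
    show "\<exists>z\<in>X. lt' z u \<and> lt' z v \<and> rk (\<phi> u) = Suc (rk (\<phi> z)) \<and> (w = z \<or> lt' w z)"
      if "x \<in> X" "u \<in> X" "v \<in> X" "w \<in> X" "u \<noteq> v" "lt' u x" "lt' v x"
        "rk (\<phi> x) = Suc (rk (\<phi> u))" "rk (\<phi> x) = Suc (rk (\<phi> v))"
        "w = u \<or> lt' w u" "w = v \<or> lt' w v" for x u v w
      using diamond[of "\<phi> x" "\<phi> u" "\<phi> v" "\<phi> w"] that lt' eq by (simp cong: bex_cong)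
    show "\<exists>w\<in>X. (w = u \<or> lt' w u) \<and> (w = v \<or> lt' w v)"
      if "x \<in> X" "u \<in> X" "v \<in> X" "lt' u x" "lt' v x"
        "rk (\<phi> x) = Suc (rk (\<phi> u))" "rk (\<phi> x) = Suc (rk (\<phi> v))" "2 < rk (\<phi> x)" for x u v
      using common_lower[of "\<phi> x" "\<phi> u" "\<phi> v"] that lt' eq by (simp cong: bex_cong)
    show "card {w \<in> X. (w = x \<or> lt' w x) \<and> rk (\<phi> w) = r} = (rk (\<phi> x) choose r) * r ^ (rk (\<phi> x) - r)"
      if x: "x \<in> X" for x r
    proof -
      have "\<phi> ` {w \<in> X. (w = x \<or> lt' w x) \<and> rk (\<phi> w) = r}
          = {w \<in> \<phi> ` X. (w = \<phi> x \<or> lt w (\<phi> x)) \<and> rk w = r}"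
        using lt' eq x by auto
      moreover have "inj_on \<phi> {w \<in> X. (w = x \<or> lt' w x) \<and> rk (\<phi> w) = r}"
        using inj by (rule inj_on_subset) blast
      ultimately show ?thesis using card_rank_below[of "\<phi> x" r] x card_image by fastforce
    qed
  qed
qed

text \<open>The description is proper because the blocks cover \<open>{1..n}\<close>, are disjoint
  and have one point each.\<close>

definition point_map :: "nat \<Rightarrow> (nat set \<times> nat) set \<Rightarrow> nat \<Rightarrow> nat" where
  "point_map n x i = (if i \<in> {1..n} then THE p. \<exists>B. (B, p) \<in> x \<and> i \<in> B else i)"

lemma pointed_partitionsD:
  assumes "x \<in> pointed_partitions n"
  shows "i \<in> {1..n} \<Longrightarrow> \<exists>B p. (B, p) \<in> x \<and> i \<in> B"
    and "(B, p) \<in> x \<Longrightarrow> B \<subseteq> {1..n}"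
    and "(B, p) \<in> x \<Longrightarrow> p \<in> B"
    and "\<lbrakk>(B, p) \<in> x; (C, q) \<in> x; i \<in> B; i \<in> C\<rbrakk> \<Longrightarrow> B = C \<and> p = q"
proof -
  have part: "partition_on {1..n} (fst ` x)" and inj: "inj_on fst x" and pt: "\<forall>(B, p)\<in>x. p \<in> B"
    using assms by (simp_all add: pointed_partitions_def)
  have U: "\<Union> (fst ` x) = {1..n}" using partition_onD1[OF part] by simp
  have block: "B \<in> fst ` x" if "(B, p) \<in> x" for B p
    using that by (rule rev_image_eqI) simp
  show "\<exists>B p. (B, p) \<in> x \<and> i \<in> B" if "i \<in> {1..n}"
    using that unfolding U[symmetric] by auto
  show "B \<subseteq> {1..n}" if "(B, p) \<in> x"
    unfolding U[symmetric] using block[OF that] by (rule Union_upper)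
  show "p \<in> B" if "(B, p) \<in> x" using that pt by blast
  show "B = C \<and> p = q" if "(B, p) \<in> x" "(C, q) \<in> x" "i \<in> B" "i \<in> C"
  proof -
    have "B = C"
      using disjointD[OF partition_onD2[OF part] block[OF that(1)] block[OF that(2)]] that(3,4) by blast
    moreover from this have "(B, p) = (C, q)" using inj_onD[OF inj _ that(1,2)] by simp
    ultimately show ?thesis by blast
  qed
qed

lemma point_map_eq:
  assumes "x \<in> pointed_partitions n" "(B, p) \<in> x" "i \<in> B"
  shows "point_map n x i = p"
proof -
  have "(THE p. \<exists>B. (B, p) \<in> x \<and> i \<in> B) = p"
    using assms pointed_partitionsD(4)[OF assms(1)] by (intro the_equality) blast+
  moreover have "i \<in> {1..n}" using pointed_partitionsD(2)[OF assms(1,2)] assms(3) by blast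
  ultimately show ?thesis by (simp add: point_map_def)
qed

text \<open>Two blocks with the same point share an element and coincide. So the fibres of the point
  map recover the pointed partition.\<close>

lemma block_eq:
  assumes x: "x \<in> pointed_partitions n" and Bp: "(B, p) \<in> x"
  shows "B = {i \<in> {1..n}. point_map n x i = p}"
proof (rule subset_antisym; rule subsetI)
  fix i assume "i \<in> B"
  then show "i \<in> {i \<in> {1..n}. point_map n x i = p}"
    using point_map_eq[OF x Bp] pointed_partitionsD(2)[OF x Bp] by blast
next
  fix i assume i: "i \<in> {i \<in> {1..n}. point_map n x i = p}"
  then obtain C q where C: "(C, q) \<in> x" "i \<in> C" using pointed_partitionsD(1)[OF x] by blast
  then have "q = p" using point_map_eq[OF x C] i by simp
  then have "B = C" using pointed_partitionsD(3,4)[OF x] Bp C(1) by blast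
  then show "i \<in> B" using C(2) by simp
qed

lemma point_map_in_idem_maps:
  assumes x: "x \<in> pointed_partitions n"
  shows "point_map n x \<in> idem_maps n"
proof -
  have inside: "point_map n x i \<in> {1..n} \<and> point_map n x (point_map n x i) = point_map n x i"
    if i: "i \<in> {1..n}" for i
  proof -
    obtain B p where B: "(B, p) \<in> x" "i \<in> B" using pointed_partitionsD(1)[OF x i] by blast
    then have "p \<in> B" "p \<in> {1..n}" using pointed_partitionsD(2,3)[OF x B(1)] by blast+
    then show ?thesis using point_map_eq[OF x B(1)] B(2) by simp
  qed
  have outside: "point_map n x i = i" if "i \<notin> {1..n}" for i
    using that unfolding point_map_def by (simp only: if_False)
  have "point_map n x (point_map n x i) = point_map n x i" for i
    using inside[of i] outside[of i] by (cases "i \<in> {1..n}") simp_all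
  then show ?thesis unfolding idem_maps_def using inside outside by blast
qed

lemma points_eq:
  assumes x: "x \<in> pointed_partitions n" and p: "p \<in> {1..n}"
  shows "point_map n x p = p \<longleftrightarrow> (\<exists>B. (B, p) \<in> x)"
proof
  assume "point_map n x p = p"
  moreover obtain B q where "(B, q) \<in> x" "p \<in> B" using pointed_partitionsD(1)[OF x p] by blast
  ultimately show "\<exists>B. (B, p) \<in> x" using point_map_eq[OF x] by metis
next
  assume "\<exists>B. (B, p) \<in> x"
  then show "point_map n x p = p" using pointed_partitionsD(3)[OF x] point_map_eq[OF x] by blast
qed

lemma pointed_le_iff:
  assumes x: "x \<in> pointed_partitions n" and y: "y \<in> pointed_partitions n"
  shows "pointed_le n x y \<longleftrightarrow> idem_le (point_map n x) (point_map n y)"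
proof
  assume le: "pointed_le n x y"
  have "point_map n x (point_map n y i) = point_map n x i \<and> point_map n y (point_map n x i) = point_map n x i" for i
  proof (cases "i \<in> {1..n}")
    case True
    obtain C q where C: "(C, q) \<in> y" "i \<in> C" using pointed_partitionsD(1)[OF y True] by blast
    then obtain B p where B: "(B, p) \<in> x" "C \<subseteq> B"
      using le unfolding pointed_le_def refines_def by force
    have "q \<in> C" using pointed_partitionsD(3)[OF y C(1)] .
    then have "point_map n y i = q" "point_map n x i = p" "point_map n x q = p"
      using point_map_eq[OF y C(1)] point_map_eq[OF x B(1)] C B by blast+
    moreover obtain C' where "(C', p) \<in> y" using le B(1) unfolding pointed_le_def by blast
    then have "point_map n y p = p" using pointed_partitionsD(3)[OF y] point_map_eq[OF y] by blast
    ultimately show ?thesis by simp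
  next
    case False
    then show ?thesis unfolding point_map_def by (simp only: if_False)
  qed
  then show "idem_le (point_map n x) (point_map n y)" by (simp add: idem_le_def)
next
  assume "idem_le (point_map n x) (point_map n y)"
  then have xy: "point_map n x (point_map n y i) = point_map n x i"
    and yx: "point_map n y (point_map n x i) = point_map n x i" for i
    by (simp_all add: idem_le_def)
  have "\<exists>B\<in>fst ` x. C \<subseteq> B" if C_y: "C \<in> fst ` y" for C
  proof -
    obtain q where C: "(C, q) \<in> y" using C_y by auto
    then have "q \<in> C" "q \<in> {1..n}" using pointed_partitionsD(2,3)[OF y C] by blast+
    then obtain B p where B: "(B, p) \<in> x" "q \<in> B" using pointed_partitionsD(1)[OF x] by blast
    \<comment> \<open>Each \<open>i\<close> in \<open>C\<close> has the same image under
      \<open>x\<close> as its point \<open>q\<close>, so it lies in the block of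
      \<open>q\<close>.\<close>
    have "C \<subseteq> B"
    proof
      fix i assume i: "i \<in> C"
      have "point_map n x i = p"
        using xy[of i] point_map_eq[OF y C i] point_map_eq[OF x B] by simp
      then show "i \<in> B" using block_eq[OF x B(1)] pointed_partitionsD(2)[OF y C] i by blast
    qed
    then show ?thesis using B(1) by force
  qed
  moreover have "\<exists>C. (C, p) \<in> y \<and> C \<subseteq> B" if B: "(B, p) \<in> x" for B p
  proof -
    have p: "p \<in> B" "p \<in> {1..n}" using pointed_partitionsD(2,3)[OF x B] by blast+
    have "point_map n x p = p" using point_map_eq[OF x B p(1)] .
    then have "point_map n y p = p" using yx[of p] by simp
    then obtain C where C: "(C, p) \<in> y" using points_eq[OF y p(2)] by blast
    have "C \<subseteq> B"
    proof
      fix i assume i: "i \<in> C"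
      have "point_map n x i = p"
        using xy[of i] point_map_eq[OF y C i] \<open>point_map n x p = p\<close> by simp
      then show "i \<in> B" using block_eq[OF x B] pointed_partitionsD(2)[OF y C] i by blast
    qed
    then show ?thesis using C by blast
  qed
  ultimately show "pointed_le n x y"
    using x y unfolding pointed_le_def refines_def pointed_partitions_def by blast
qed

lemma inj_on_point_map: "inj_on (point_map n) (pointed_partitions n)"
proof -
  have sub: "x \<subseteq> y" if x: "x \<in> pointed_partitions n" and y: "y \<in> pointed_partitions n"
    and eq: "point_map n x = point_map n y" for x y
  proof
    fix b assume "b \<in> x"
    then obtain B p where b: "b = (B, p)" "(B, p) \<in> x" by (cases b) blast
    have p: "p \<in> {1..n}" using pointed_partitionsD(2,3)[OF x b(2)] by blast
    then obtain C where C: "(C, p) \<in> y" using points_eq[OF x p] points_eq[OF y p] b(2) eq by auto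
    then have "B = C" using block_eq[OF x b(2)] block_eq[OF y C] eq by simp
    then show "b \<in> y" using C b(1) by simp
  qed
  show ?thesis
    by (rule inj_onI, rule subset_antisym) (simp_all add: sub)
qed

lemma image_point_map: "point_map n ` pointed_partitions n = idem_maps n"
proof
  show "point_map n ` pointed_partitions n \<subseteq> idem_maps n" using point_map_in_idem_maps by blast
  show "idem_maps n \<subseteq> point_map n ` pointed_partitions n"
  proof
    fix h assume h: "h \<in> idem_maps n"
    define blk where "blk p = {i \<in> {1..n}. h i = p}" for p
    \<comment> \<open>The fibres of \<open>h\<close>, each pointed by the common value of
      \<open>h\<close> on it; idempotency puts that value inside the fibre.\<close>
    define x where "x = (\<lambda>p. (blk p, p)) ` h ` {1..n}"
    have hh: "h (h i) = h i" and hin: "i \<in> {1..n} \<Longrightarrow> h i \<in> {1..n}" for i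
      using h unfolding idem_maps_def by blast+
    have mem: "(B, p) \<in> x \<longleftrightarrow> p \<in> h ` {1..n} \<and> B = blk p" for B p
      by (auto simp: x_def)
    have pt: "p \<in> blk p" if "p \<in> h ` {1..n}" for p
      using that hh hin unfolding blk_def by blast
    have fst_x: "fst ` x = blk ` h ` {1..n}" by (simp add: x_def image_image)
    have "partition_on {1..n} (fst ` x)"
    proof (rule partition_onI)
      show "\<Union> (fst ` x) = {1..n}" unfolding fst_x blk_def by blast
      show "{} \<notin> fst ` x" unfolding fst_x using pt by blast
      show "disjnt B C" if "B \<in> fst ` x" "C \<in> fst ` x" "B \<noteq> C" for B C
      proof -
        obtain p q where "B = blk p" "C = blk q" using \<open>B \<in> fst ` x\<close> \<open>C \<in> fst ` x\<close> unfolding fst_x by blast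
        moreover from this have "p \<noteq> q" using \<open>B \<noteq> C\<close> by blast
        ultimately show ?thesis unfolding disjnt_def blk_def by blast
      qed
    qed
    moreover have "inj_on fst x"
    proof (rule inj_onI)
      fix a b assume ab: "a \<in> x" "b \<in> x" "fst a = fst b"
      then obtain p q where p: "p \<in> h ` {1..n}" "a = (blk p, p)" and q: "b = (blk q, q)"
        unfolding x_def by blast
      have "p \<in> blk q" using pt[OF p(1)] ab(3) p(2) q by simp
      then have "p = q" using pt[OF p(1)] by (simp add: blk_def)
      then show "a = b" using p(2) q by simp
    qed
    ultimately have x: "x \<in> pointed_partitions n"
      unfolding pointed_partitions_def using pt by (auto simp: x_def)
    have "point_map n x i = h i" for i
    proof (cases "i \<in> {1..n}")
      case True
      then have "(blk (h i), h i) \<in> x" "i \<in> blk (h i)" unfolding mem blk_def by blast+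
      then show ?thesis by (rule point_map_eq[OF x])
    next
      case False
      then have "h i = i" using h unfolding idem_maps_def by blast
      with False show ?thesis unfolding point_map_def by (simp only: if_False)
    qed
    then have "point_map n x = h" ..
    then show "h \<in> point_map n ` pointed_partitions n" using x by blast
  qed
qed

lemma strictly_pointed_le_iff:
  assumes "x \<in> pointed_partitions n" "y \<in> pointed_partitions n"
  shows "strictly (pointed_le n) x y \<longleftrightarrow> strictly idem_le (point_map n x) (point_map n y)"
  using pointed_le_iff[OF assms] inj_on_eq_iff[OF inj_on_point_map assms] by (simp add: strictly_def)

lemma abel_poset_pointed_partitions:
  assumes "1 \<le> n"
  shows "abel_poset (pointed_partitions n) (strictly (pointed_le n)) (\<lambda>x. idem_rank n (point_map n x))"
proof (rule abel_poset_pullback[where \<phi> = "point_map n" and lt = "strictly idem_le" and rk = "idem_rank n"])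
  show "abel_poset (point_map n ` pointed_partitions n) (strictly idem_le) (idem_rank n)"
    unfolding image_point_map by (rule abel_poset_idem_maps[OF assms])
qed (rule inj_on_point_map, rule strictly_pointed_le_iff)

theorem proposition4p19:
  fixes n :: nat
  assumes "n \<ge> 1"
  shows "(\<forall>k. k \<noteq> n - 1 \<longrightarrow>
      carrier (pointed_partition_cohomology n k :: ('k::comm_ring_1, _) module) =
        {\<zero>\<^bsub>pointed_partition_cohomology n k\<^esub>}) \<and>
    free_of_rank (class_ring :: 'k ring) (pointed_partition_cohomology n (n - 1)) ((n - 1) ^ (n - 1))"
proof -
  interpret abel_poset "pointed_partitions n" "strictly (pointed_le n)" "\<lambda>x. idem_rank n (point_map n x)"
    using assms by (rule abel_poset_pointed_partitions)
  \<comment> \<open>The identity corresponds to the partition into singletons, the greatest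
    element.\<close>
  have "(\<lambda>i. i) \<in> idem_maps n" by (simp add: idem_maps_def)
  then obtain t where t: "t \<in> pointed_partitions n" "point_map n t = (\<lambda>i. i)"
    unfolding image_point_map[symmetric] by force
  have le_t: "pointed_le n x t" if "x \<in> pointed_partitions n" for x
    using pointed_le_iff[OF that t(1)] t(2) by (simp add: idem_le_def)
  have lt_t: "strictly (pointed_le n) x t" if "x \<in> pointed_partitions n" "x \<noteq> t" for x
    using le_t that by (simp add: strictly_def)
  have t_max: "\<not> strictly (pointed_le n) t x" if "x \<in> pointed_partitions n" for x
    using lt_t[OF that] lt_trans[OF t(1) that t(1)] lt_irrefl[OF t(1)] by blast
  interpret top_poset "pointed_partitions n" "pointed_le n" t
  proof
    show "max_elements (pointed_partitions n) (pointed_le n) = {t}"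
      unfolding max_elements_def using t(1) t_max lt_t by blast
  qed (use finite_P t(1) le_t lt_trans in blast)+
  have "below t = pointed_partitions n - {t}"
    unfolding below_def using lt_t lt_irrefl by blast
  \<comment> \<open>The degree is one less than this rank, because ranks start at 1.\<close>
  moreover have "idem_rank n (point_map n t) = n" by (simp add: t(2) idem_rank_def)
  ultimately obtain B where
    "spherical TYPE('k) (strictly (pointed_le n)) (pointed_partitions n - {t}) (n - 1) B"
    "card B = (n - 1) ^ (n - 1)"
    using spherical_below_card[OF t(1), of "TYPE('k)"] by auto
  then show ?thesis
    using cohomology_spherical[of "TYPE('k)"] unfolding pointed_partition_cohomology_def by metis
qed

end
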